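(* Let $\mathfrak{G}$ be a group, let $X$ be a finite set with $|X|=n$, and let $K_n$ be the complete graph on the vertex set $X$. The partition-potential Rhodes semilattice $R_n(\mathfrak{G})$ is isomorphic, as a meet-semilattice, to the graphic Rhodes semilattice $R^{\mathrm{b}}(\mathfrak{G}\cdot K_n)$ of closed and balanced subgraphs of the group expansion $\mathfrak{G}\cdot K_n$.
   Context: Partial partitions. A partial partition $\pi=\{\pi_1,\dots,\pi_j\}$ of $X$ is a partition (into nonempty blocks) of a subset of $X$; this subset, the union of the blocks, is denoted $\operatorname{supp}\pi$ (the empty partial partition is allowed). Say $\tau\le\pi$ ($\tau$ refines $\pi$) if every block of $\tau$ is contained in a block of $\pi$. Potential systems. $\mathfrak{G}$ acts on functions $\theta: I\to\mathfrak{G}$ ($I\subseteq X$) by $(g\theta)(x)=g\,\theta(x)$. Let $\pi$ be a partial partition, and let $\theta:Y\to\mathfrak{G}$, $\eta:Z\to\mathfrak{G}$ with $Y,Z\subseteq X$ both containing $\operatorname{supp}\pi$. Write $\eta\sim_\pi\theta$ if $\eta|_{\pi_i}\in\mathfrak{G}\cdot\theta|_{\pi_i}$ for each block $\pi_i$ of $\pi$. This is an equivalence relation; the class of $\theta$ is denoted $[\theta]_\pi$ and is called a potential system on $\pi$. The partition-potential Rhodes semilattice $R_n(\mathfrak{G})$ is the set of all pairs $(\pi,[\theta]_\pi)$ with $\pi$ a partial partition of $X$ and $[\theta]_\pi$ a potential system on $\pi$, ordered by $(\tau,[\eta]_\tau)\le(\pi,[\theta]_\pi)$ iff $\tau$ refines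 $\pi$ and $[\eta]_\tau=[\theta]_\tau$. Its meet is $(\pi,[\theta]_\pi)\wedge(\tau,[\eta]_\tau)=(\rho,[\theta]_\rho)=(\rho,[\eta]_\rho)$, where $\rho$ is the partition of $\operatorname{supp}\rho=\operatorname{supp}\pi\cap\operatorname{supp}\tau$ into classes of the equivalence relation: $x\sim y$ iff there are blocks $\tau_i\in\tau$, $\pi_j\in\pi$ with $x,y\in\tau_i\cap\pi_j$ and $\theta(x)^{-1}\theta(y)=\eta(x)^{-1}\eta(y)$. Gain graphs. A gain graph $\Phi=(\Gamma,\phi,\mathfrak{G})$ is a graph $\Gamma$ (loops and multiple edges allowed) with a gain function $\phi$ assigning to each oriented edge an element of $\mathfrak{G}$ so that reversing the direction inverts the gain; $\phi(e;v,w)$ is the gain of $e$ oriented from $v$ to $w$, and $\phi(e;w,v)=\phi(e;v,w)^{-1}$. The gain of a path $v_0e_1v_1\cdots e_kv_k$ is $\phi(e_1;v_0,v_1)\cdots\phi(e_k;v_{k-1},v_k)$. A circle (the graph of a simple closed path, including loops and pairs of parallel edges) is balanced if its gain as a closed path is $1$ (independent of its representation as a closed path). A subgraph (a set of vertices and a set of edges with endpoints in it; isolated vertices and the empty subgraph are allowed) is balanced if every circle in it is balanced. A subgraph $\Upsilon$ of $\Phi$ is closed and balanced if it is balanced and, whenever $C\subseteq\Phi$ is a balanced circle and $e$ is an edge of $C$ with $C\setminus e\subseteq\Upsilon$ (where $C\setminus e$ is $C$ with the edge $e$ deleted, all vertices retained), then $e\in E(\Upsilon)$. Group expansion. For a graph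 $\Gamma$, $\mathfrak{G}\cdot\Gamma$ is the gain graph with vertex set $V(\Gamma)$ and edge set $\mathfrak{G}\times E(\Gamma)$, where $(g,e)$ has the same endpoints as $e$; after fixing an arbitrary orientation $(e;v,w)$ of each edge $e$, the gains are $\phi((g,e);v,w)=g$ and $\phi((g,e);w,v)=g^{-1}$. The graphic Rhodes semilattice $R^{\mathrm{b}}(\mathfrak{G}\cdot K_n)$ is the family of closed and balanced subgraphs of $\mathfrak{G}\cdot K_n$, ordered by inclusion, with meet operation intersection (of vertex sets and of edge sets). *)

theory Defs
  imports "HOL-Algebra.Group" "HOL-Algebra.Order" "HOL-Library.Disjoint_Sets"
begin

section \<open>Meet-semilattices and their isomorphisms\<close>

record 'a meet_gorder = "'a gorder" +
  wedge :: "'a \<Rightarrow> 'a \<Rightarrow> 'a" (infixl \<open>\<triangle>\<index>\<close> 70)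

locale meet_semilattice = partial_order S for S (structure) +
  assumes wedge_greatest:
    "\<lbrakk>x \<in> carrier S; y \<in> carrier S\<rbrakk> \<Longrightarrow> greatest S (x \<triangle> y) (Lower S {x, y})"

definition meet_semilattice_iso ::
    "('a \<Rightarrow> 'b) \<Rightarrow> ('a, 'k) meet_gorder_scheme \<Rightarrow> ('b, 'l) meet_gorder_scheme \<Rightarrow> bool" where
  "meet_semilattice_iso f S T \<longleftrightarrow>
     bij_betw f (carrier S) (carrier T) \<and>
     (\<forall>x\<in>carrier S. \<forall>y\<in>carrier S. f (x \<triangle>\<^bsub>S\<^esub> y) = f x \<triangle>\<^bsub>T\<^esub> f y) \<and>
     (\<forall>x\<in>carrier S. \<forall>y\<in>carrier S. x \<sqsubseteq>\<^bsub>S\<^esub> y \<longleftrightarrow> f x \<sqsubseteq>\<^bsub>T\<^esub> f y)"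


section \<open>Partial partitions and potential systems\<close>

definition partial_partition :: "'x set \<Rightarrow> 'x set set \<Rightarrow> bool" where
  "partial_partition X \<pi> \<longleftrightarrow> (\<exists>A\<subseteq>X. partition_on A \<pi>)"

abbreviation supp :: "'x set set \<Rightarrow> 'x set" where
  "supp \<pi> \<equiv> \<Union>\<pi>"

definition refining :: "'x set set \<Rightarrow> 'x set set \<Rightarrow> bool" where
  "refining \<tau> \<pi> \<longleftrightarrow> (\<forall>B\<in>\<tau>. \<exists>C\<in>\<pi>. B \<subseteq> C)"

text \<open>
  A function from a subset \<open>Y\<close> of \<open>X\<close> into the group is a partial map \<open>\<theta>\<close> with \<open>dom \<theta> = Y\<close>
  and \<open>ran \<theta> \<subseteq> carrier G\<close>, so its domain of definition is part of the object.
\<close>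

definition act :: "('g, 'm) monoid_scheme \<Rightarrow> 'g \<Rightarrow> ('x \<rightharpoonup> 'g) \<Rightarrow> ('x \<rightharpoonup> 'g)" where
  "act G g \<theta> = (\<lambda>x. map_option (\<lambda>h. g \<otimes>\<^bsub>G\<^esub> h) (\<theta> x))"

definition potentials :: "('g, 'm) monoid_scheme \<Rightarrow> 'x set \<Rightarrow> 'x set set \<Rightarrow> ('x \<rightharpoonup> 'g) set" where
  "potentials G X \<pi> = {\<theta>. supp \<pi> \<subseteq> dom \<theta> \<and> dom \<theta> \<subseteq> X \<and> ran \<theta> \<subseteq> carrier G}"

definition potential_equiv ::
    "('g, 'm) monoid_scheme \<Rightarrow> 'x set set \<Rightarrow> ('x \<rightharpoonup> 'g) \<Rightarrow> ('x \<rightharpoonup> 'g) \<Rightarrow> bool" where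
  "potential_equiv G \<pi> \<eta> \<theta> \<longleftrightarrow> (\<forall>B\<in>\<pi>. \<exists>g\<in>carrier G. \<eta> |` B = act G g (\<theta> |` B))"

definition potential_class ::
    "('g, 'm) monoid_scheme \<Rightarrow> 'x set \<Rightarrow> 'x set set \<Rightarrow> ('x \<rightharpoonup> 'g) \<Rightarrow> ('x \<rightharpoonup> 'g) set" where
  "potential_class G X \<pi> \<theta> = {\<eta> \<in> potentials G X \<pi>. potential_equiv G \<pi> \<eta> \<theta>}"


section \<open>The partition-potential Rhodes semilattice\<close>

type_synonym ('x, 'g) partition_potential = "'x set set \<times> ('x \<rightharpoonup> 'g) set"

definition rhodes_carrier ::
    "('g, 'm) monoid_scheme \<Rightarrow> 'x set \<Rightarrow> ('x, 'g) partition_potential set" where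
  "rhodes_carrier G X =
     {(\<pi>, potential_class G X \<pi> \<theta>) | \<pi> \<theta>. partial_partition X \<pi> \<and> \<theta> \<in> potentials G X \<pi>}"

text \<open>
  The order and the meet are given through representatives of the potential systems; that the
  choice of representatives is immaterial is shown in \<open>rhodes_le_eq\<close> and \<open>rhodes_meet_eq\<close>.
\<close>

definition rep :: "('x \<rightharpoonup> 'g) set \<Rightarrow> ('x \<rightharpoonup> 'g)" where
  "rep T = (SOME \<theta>. \<theta> \<in> T)"

definition rhodes_le ::
    "('g, 'm) monoid_scheme \<Rightarrow> 'x set \<Rightarrow>
      ('x, 'g) partition_potential \<Rightarrow> ('x, 'g) partition_potential \<Rightarrow> bool" where
  "rhodes_le G X = (\<lambda>(\<tau>, E) (\<pi>, T).
     refining \<tau> \<pi> \<and> potential_class G X \<tau> (rep E) = potential_class G X \<tau> (rep T))"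

definition meet_rel ::
    "('g, 'm) monoid_scheme \<Rightarrow> 'x set set \<Rightarrow> ('x \<rightharpoonup> 'g) \<Rightarrow> 'x set set \<Rightarrow> ('x \<rightharpoonup> 'g) \<Rightarrow> 'x rel" where
  "meet_rel G \<pi> \<theta> \<tau> \<eta> = {(x, y). \<exists>B\<in>\<tau>. \<exists>C\<in>\<pi>. x \<in> B \<inter> C \<and> y \<in> B \<inter> C \<and>
     inv\<^bsub>G\<^esub> (the (\<theta> x)) \<otimes>\<^bsub>G\<^esub> the (\<theta> y) = inv\<^bsub>G\<^esub> (the (\<eta> x)) \<otimes>\<^bsub>G\<^esub> the (\<eta> y)}"

definition meet_partition ::
    "('g, 'm) monoid_scheme \<Rightarrow> 'x set set \<Rightarrow> ('x \<rightharpoonup> 'g) \<Rightarrow> 'x set set \<Rightarrow> ('x \<rightharpoonup> 'g) \<Rightarrow> 'x set set" where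
  "meet_partition G \<pi> \<theta> \<tau> \<eta> = (supp \<pi> \<inter> supp \<tau>) // meet_rel G \<pi> \<theta> \<tau> \<eta>"

definition rhodes_meet ::
    "('g, 'm) monoid_scheme \<Rightarrow> 'x set \<Rightarrow>
      ('x, 'g) partition_potential \<Rightarrow> ('x, 'g) partition_potential \<Rightarrow> ('x, 'g) partition_potential" where
  "rhodes_meet G X = (\<lambda>(\<pi>, T) (\<tau>, E).
     let \<rho> = meet_partition G \<pi> (rep T) \<tau> (rep E) in (\<rho>, potential_class G X \<rho> (rep T)))"

definition partition_rhodes ::
    "('g, 'm) monoid_scheme \<Rightarrow> 'x set \<Rightarrow> ('x, 'g) partition_potential meet_gorder" where
  "partition_rhodes G X =
     \<lparr>carrier = rhodes_carrier G X, eq = (=), le = rhodes_le G X, wedge = rhodes_meet G X\<rparr>"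

subsection \<open>Independence of the representatives\<close>

lemma act_restrict_iff:
  assumes "B \<subseteq> dom \<eta>" "B \<subseteq> dom \<theta>"
  shows "\<eta> |` B = act G g (\<theta> |` B) \<longleftrightarrow> (\<forall>x\<in>B. the (\<eta> x) = g \<otimes>\<^bsub>G\<^esub> the (\<theta> x))"
proof -
  have "\<eta> |` B = act G g (\<theta> |` B) \<longleftrightarrow> (\<forall>x\<in>B. \<eta> x = map_option (\<lambda>h. g \<otimes>\<^bsub>G\<^esub> h) (\<theta> x))"
    by (auto simp: fun_eq_iff act_def restrict_map_def)
  also have "\<dots> \<longleftrightarrow> (\<forall>x\<in>B. the (\<eta> x) = g \<otimes>\<^bsub>G\<^esub> the (\<theta> x))"
  proof (rule ball_cong[OF refl])
    fix x assume "x \<in> B"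
    then obtain a b where "\<eta> x = Some a" "\<theta> x = Some b" using assms by blast
    then show "\<eta> x = map_option (\<lambda>h. g \<otimes>\<^bsub>G\<^esub> h) (\<theta> x) \<longleftrightarrow> the (\<eta> x) = g \<otimes>\<^bsub>G\<^esub> the (\<theta> x)" by simp
  qed
  finally show ?thesis .
qed

lemma potential_equiv_iff:
  assumes "\<eta> \<in> potentials G X \<pi>" "\<theta> \<in> potentials G X \<pi>"
  shows "potential_equiv G \<pi> \<eta> \<theta> \<longleftrightarrow>
    (\<forall>B\<in>\<pi>. \<exists>g\<in>carrier G. \<forall>x\<in>B. the (\<eta> x) = g \<otimes>\<^bsub>G\<^esub> the (\<theta> x))"
proof -
  have "B \<subseteq> dom \<eta>" "B \<subseteq> dom \<theta>" if "B \<in> \<pi>" for B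
    using assms that unfolding potentials_def by auto
  then show ?thesis by (simp add: potential_equiv_def act_restrict_iff)
qed

lemma potentials_carrier:
  assumes "\<theta> \<in> potentials G X \<pi>" "B \<in> \<pi>" "x \<in> B"
  shows "the (\<theta> x) \<in> carrier G"
proof -
  obtain a where "\<theta> x = Some a" using assms unfolding potentials_def by blast
  then show ?thesis using assms unfolding potentials_def by (auto intro: ranI)
qed

lemma disjoint_block_eq:
  "disjoint P \<Longrightarrow> B \<in> P \<Longrightarrow> B' \<in> P \<Longrightarrow> x \<in> B \<Longrightarrow> x \<in> B' \<Longrightarrow> B = B'"
  unfolding disjoint_def by blast

context group
begin

lemma potential_equiv_refl:
  assumes "\<theta> \<in> potentials G X \<pi>"
  shows "potential_equiv G \<pi> \<theta> \<theta>"
  unfolding potential_equiv_iff[OF assms assms]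
  using potentials_carrier[OF assms] by (intro ballI bexI[of _ \<one>]) simp_all

lemma potential_equiv_sym:
  assumes "\<theta> \<in> potentials G X \<pi>" "\<eta> \<in> potentials G X \<pi>" "potential_equiv G \<pi> \<eta> \<theta>"
  shows "potential_equiv G \<pi> \<theta> \<eta>"
  unfolding potential_equiv_iff[OF assms(1,2)]
proof
  fix B assume B: "B \<in> \<pi>"
  then obtain g where g: "g \<in> carrier G" "\<forall>x\<in>B. the (\<eta> x) = g \<otimes> the (\<theta> x)"
    using assms(3) potential_equiv_iff[OF assms(2,1)] by blast
  have "the (\<theta> x) = inv g \<otimes> the (\<eta> x)" if "x \<in> B" for x
    using g that potentials_carrier[OF assms(1) B that] by (simp add: m_assoc[symmetric])
  then show "\<exists>g\<in>carrier G. \<forall>x\<in>B. the (\<theta> x) = g \<otimes> the (\<eta> x)" using g by blast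
qed

lemma potential_equiv_trans:
  assumes "\<theta> \<in> potentials G X \<pi>" "\<eta> \<in> potentials G X \<pi>" "\<zeta> \<in> potentials G X \<pi>"
    and "potential_equiv G \<pi> \<theta> \<eta>" "potential_equiv G \<pi> \<eta> \<zeta>"
  shows "potential_equiv G \<pi> \<theta> \<zeta>"
  unfolding potential_equiv_iff[OF assms(1,3)]
proof
  fix B assume B: "B \<in> \<pi>"
  obtain g where g: "g \<in> carrier G" "\<forall>x\<in>B. the (\<theta> x) = g \<otimes> the (\<eta> x)"
    using assms(4) potential_equiv_iff[OF assms(1,2)] B by blast
  obtain h where h: "h \<in> carrier G" "\<forall>x\<in>B. the (\<eta> x) = h \<otimes> the (\<zeta> x)"
    using assms(5) potential_equiv_iff[OF assms(2,3)] B by blast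
  have "the (\<theta> x) = (g \<otimes> h) \<otimes> the (\<zeta> x)" if "x \<in> B" for x
    using g h that potentials_carrier[OF assms(3) B that] by (simp add: m_assoc)
  then show "\<exists>g\<in>carrier G. \<forall>x\<in>B. the (\<theta> x) = g \<otimes> the (\<zeta> x)"
    using g(1) h(1) m_closed by blast
qed

lemma potential_class_eq_iff:
  assumes "\<theta> \<in> potentials G X \<pi>" "\<eta> \<in> potentials G X \<pi>"
  shows "potential_class G X \<pi> \<theta> = potential_class G X \<pi> \<eta> \<longleftrightarrow> potential_equiv G \<pi> \<theta> \<eta>"
proof
  assume "potential_class G X \<pi> \<theta> = potential_class G X \<pi> \<eta>"
  moreover have "\<theta> \<in> potential_class G X \<pi> \<theta>"
    using potential_equiv_refl[OF assms(1)] assms(1) by (simp add: potential_class_def)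
  ultimately show "potential_equiv G \<pi> \<theta> \<eta>" by (simp add: potential_class_def)
next
  assume e: "potential_equiv G \<pi> \<theta> \<eta>"
  have "potential_equiv G \<pi> \<zeta> \<theta> \<longleftrightarrow> potential_equiv G \<pi> \<zeta> \<eta>" if "\<zeta> \<in> potentials G X \<pi>" for \<zeta>
    using potential_equiv_trans[OF that assms _ e]
      potential_equiv_trans[OF that assms(2,1) _ potential_equiv_sym[OF assms(2,1) e]] by metis
  then show "potential_class G X \<pi> \<theta> = potential_class G X \<pi> \<eta>"
    unfolding potential_class_def by (intro Collect_cong conj_cong) auto
qed

lemma rep_class:
  assumes "\<theta> \<in> potentials G X \<pi>"
  shows "rep (potential_class G X \<pi> \<theta>) \<in> potentials G X \<pi>"
    and "potential_equiv G \<pi> (rep (potential_class G X \<pi> \<theta>)) \<theta>"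
proof -
  have "\<theta> \<in> potential_class G X \<pi> \<theta>"
    using assms potential_equiv_refl by (simp add: potential_class_def)
  then have "rep (potential_class G X \<pi> \<theta>) \<in> potential_class G X \<pi> \<theta>"
    unfolding rep_def by (metis someI)
  then show "rep (potential_class G X \<pi> \<theta>) \<in> potentials G X \<pi>"
    "potential_equiv G \<pi> (rep (potential_class G X \<pi> \<theta>)) \<theta>"
    by (simp_all add: potential_class_def)
qed

lemma potential_equiv_refining:
  "refining \<tau> \<pi> \<Longrightarrow> potential_equiv G \<pi> \<eta> \<theta> \<Longrightarrow> \<eta> \<in> potentials G X \<pi> \<Longrightarrow> \<theta> \<in> potentials G X \<pi> \<Longrightarrow>
    \<eta> \<in> potentials G X \<tau> \<and> \<theta> \<in> potentials G X \<tau> \<and> potential_equiv G \<tau> \<eta> \<theta>"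
proof -
  assume r: "refining \<tau> \<pi>" and e: "potential_equiv G \<pi> \<eta> \<theta>"
    and p: "\<eta> \<in> potentials G X \<pi>" "\<theta> \<in> potentials G X \<pi>"
  have "supp \<tau> \<subseteq> supp \<pi>" using r unfolding refining_def by blast
  then have q: "\<eta> \<in> potentials G X \<tau>" "\<theta> \<in> potentials G X \<tau>"
    using p unfolding potentials_def mem_Collect_eq by (meson order_trans)+
  moreover have "potential_equiv G \<tau> \<eta> \<theta>"
    using r e unfolding potential_equiv_iff[OF p] potential_equiv_iff[OF q] refining_def
    by (meson subsetD)
  ultimately show ?thesis by blast
qed

lemma potential_class_rep:
  assumes "\<theta> \<in> potentials G X \<pi>" "refining \<tau> \<pi>"
  shows "potential_class G X \<tau> (rep (potential_class G X \<pi> \<theta>)) = potential_class G X \<tau> \<theta>"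
  using potential_equiv_refining[OF assms(2) rep_class(2)[OF assms(1)] rep_class(1)[OF assms(1)] assms(1)]
  by (simp add: potential_class_eq_iff)

lemma rhodes_le_eq:
  assumes "\<eta> \<in> potentials G X \<tau>" "\<theta> \<in> potentials G X \<pi>"
  shows "rhodes_le G X (\<tau>, potential_class G X \<tau> \<eta>) (\<pi>, potential_class G X \<pi> \<theta>) \<longleftrightarrow>
    refining \<tau> \<pi> \<and> potential_class G X \<tau> \<eta> = potential_class G X \<tau> \<theta>"
proof -
  have "refining \<tau> \<tau>" by (auto simp: refining_def)
  from potential_class_rep[OF assms(1) this] potential_class_rep[OF assms(2)]
  show ?thesis by (auto simp: rhodes_le_def)
qed

lemma quotient_potential_equiv:
  assumes "\<theta> \<in> potentials G X \<pi>" "\<theta>' \<in> potentials G X \<pi>" "potential_equiv G \<pi> \<theta>' \<theta>"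
    and "C \<in> \<pi>" "x \<in> C" "y \<in> C"
  shows "inv (the (\<theta>' x)) \<otimes> the (\<theta>' y) = inv (the (\<theta> x)) \<otimes> the (\<theta> y)"
proof -
  obtain g where g: "g \<in> carrier G" "\<forall>x\<in>C. the (\<theta>' x) = g \<otimes> the (\<theta> x)"
    using assms potential_equiv_iff[OF assms(2,1)] by blast
  have c: "the (\<theta> x) \<in> carrier G" "the (\<theta> y) \<in> carrier G"
    using assms potentials_carrier[OF assms(1)] by auto
  have "inv g \<otimes> (g \<otimes> the (\<theta> y)) = the (\<theta> y)"
    using g(1) c by (simp add: m_assoc[symmetric])
  then show ?thesis using g c assms(5,6) by (simp add: inv_mult_group m_assoc)
qed

lemma meet_partition_cong:
  assumes "\<theta> \<in> potentials G X \<pi>" "\<theta>' \<in> potentials G X \<pi>" "potential_equiv G \<pi> \<theta>' \<theta>"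
    and "\<eta> \<in> potentials G X \<tau>" "\<eta>' \<in> potentials G X \<tau>" "potential_equiv G \<tau> \<eta>' \<eta>"
  shows "meet_partition G \<pi> \<theta>' \<tau> \<eta>' = meet_partition G \<pi> \<theta> \<tau> \<eta>"
proof -
  have "meet_rel G \<pi> \<theta>' \<tau> \<eta>' = meet_rel G \<pi> \<theta> \<tau> \<eta>"
    unfolding meet_rel_def
    by (rule Collect_cong, simp only: split_beta, intro bex_cong refl conj_cong)
      (simp add: quotient_potential_equiv[OF assms(1-3)] quotient_potential_equiv[OF assms(4-6)])
  then show ?thesis by (simp add: meet_partition_def)
qed

lemma meet_partition_block:
  assumes "D \<in> meet_partition G \<pi> \<theta> \<tau> \<eta>"
  obtains x where "x \<in> supp \<pi> \<inter> supp \<tau>" "D = meet_rel G \<pi> \<theta> \<tau> \<eta> `` {x}"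
  using assms unfolding meet_partition_def quotient_def by blast

lemma refining_meet_partition:
  assumes "disjoint \<pi>" "disjoint \<tau>"
  shows "refining (meet_partition G \<pi> \<theta> \<tau> \<eta>) \<pi>" "refining (meet_partition G \<pi> \<theta> \<tau> \<eta>) \<tau>"
proof -
  show "refining (meet_partition G \<pi> \<theta> \<tau> \<eta>) \<pi>"
    unfolding refining_def
  proof
    fix D assume "D \<in> meet_partition G \<pi> \<theta> \<tau> \<eta>"
    then obtain x where x: "x \<in> supp \<pi> \<inter> supp \<tau>" "D = meet_rel G \<pi> \<theta> \<tau> \<eta> `` {x}"
      by (rule meet_partition_block)
    then obtain C where C: "C \<in> \<pi>" "x \<in> C" by blast
    have "y \<in> C" if y: "y \<in> D" for y
    proof -
      obtain C' where "C' \<in> \<pi>" "x \<in> C'" "y \<in> C'"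
        using y unfolding x(2) meet_rel_def by auto
      then show ?thesis using disjoint_block_eq[OF assms(1) C(1) _ C(2)] by auto
    qed
    then have "D \<subseteq> C" by (rule subsetI)
    then show "\<exists>C\<in>\<pi>. D \<subseteq> C" using C by blast
  qed
  show "refining (meet_partition G \<pi> \<theta> \<tau> \<eta>) \<tau>"
    unfolding refining_def
  proof
    fix D assume "D \<in> meet_partition G \<pi> \<theta> \<tau> \<eta>"
    then obtain x where x: "x \<in> supp \<pi> \<inter> supp \<tau>" "D = meet_rel G \<pi> \<theta> \<tau> \<eta> `` {x}"
      by (rule meet_partition_block)
    then obtain C where C: "C \<in> \<tau>" "x \<in> C" by blast
    have "y \<in> C" if y: "y \<in> D" for y
    proof -
      obtain C' where "C' \<in> \<tau>" "x \<in> C'" "y \<in> C'"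
        using y unfolding x(2) meet_rel_def by auto
      then show ?thesis using disjoint_block_eq[OF assms(2) C(1) _ C(2)] by auto
    qed
    then have "D \<subseteq> C" by (rule subsetI)
    then show "\<exists>C\<in>\<tau>. D \<subseteq> C" using C by blast
  qed
qed

lemma rhodes_meet_eq:
  assumes "disjoint \<pi>" "\<theta> \<in> potentials G X \<pi>" "disjoint \<tau>" "\<eta> \<in> potentials G X \<tau>"
  defines "\<rho> \<equiv> meet_partition G \<pi> \<theta> \<tau> \<eta>"
  shows "rhodes_meet G X (\<pi>, potential_class G X \<pi> \<theta>) (\<tau>, potential_class G X \<tau> \<eta>) =
      (\<rho>, potential_class G X \<rho> \<theta>)"
    and "potential_class G X \<rho> \<theta> = potential_class G X \<rho> \<eta>"
proof -
  let ?e = "rep (potential_class G X \<tau> \<eta>)" and ?t = "rep (potential_class G X \<pi> \<theta>)"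
  have r: "refining \<rho> \<pi>" "refining \<rho> \<tau>"
    unfolding \<rho>_def using refining_meet_partition[OF assms(1,3)] by simp_all
  have m: "meet_partition G \<pi> ?t \<tau> ?e = \<rho>"
    unfolding \<rho>_def
    by (rule meet_partition_cong[OF assms(2) rep_class[OF assms(2)] assms(4) rep_class[OF assms(4)]])
  have "potential_class G X \<rho> ?t = potential_class G X \<rho> \<theta>"
    by (rule potential_class_rep[OF assms(2) r(1)])
  then show "rhodes_meet G X (\<pi>, potential_class G X \<pi> \<theta>) (\<tau>, potential_class G X \<tau> \<eta>) =
      (\<rho>, potential_class G X \<rho> \<theta>)"
    by (simp add: rhodes_meet_def m)
  have p: "\<theta> \<in> potentials G X \<rho>" "\<eta> \<in> potentials G X \<rho>"
    using potential_equiv_refining[OF r(1) potential_equiv_refl[OF assms(2)] assms(2,2)]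
      potential_equiv_refining[OF r(2) potential_equiv_refl[OF assms(4)] assms(4,4)] by simp_all
  have "potential_equiv G \<rho> \<theta> \<eta>"
    unfolding potential_equiv_iff[OF p]
  proof
    fix D assume D: "D \<in> \<rho>"
    then obtain x where x: "x \<in> supp \<pi> \<inter> supp \<tau>" "D = meet_rel G \<pi> \<theta> \<tau> \<eta> `` {x}"
      unfolding \<rho>_def by (rule meet_partition_block)
    let ?g = "the (\<theta> x) \<otimes> inv (the (\<eta> x))"
    have cx: "the (\<theta> x) \<in> carrier G" "the (\<eta> x) \<in> carrier G"
      using x(1) potentials_carrier[OF assms(2)] potentials_carrier[OF assms(4)] by auto
    have "the (\<theta> y) = ?g \<otimes> the (\<eta> y)" if y: "y \<in> D" for y
    proof -
      have cy: "the (\<theta> y) \<in> carrier G" "the (\<eta> y) \<in> carrier G"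
        using y D potentials_carrier[OF p(1)] potentials_carrier[OF p(2)] by auto
      have "inv (the (\<theta> x)) \<otimes> the (\<theta> y) = inv (the (\<eta> x)) \<otimes> the (\<eta> y)"
        using x(2) y by (auto simp: meet_rel_def)
      then have "the (\<theta> x) \<otimes> (inv (the (\<theta> x)) \<otimes> the (\<theta> y)) =
          the (\<theta> x) \<otimes> (inv (the (\<eta> x)) \<otimes> the (\<eta> y))" by simp
      then show ?thesis using cx cy by (simp add: m_assoc[symmetric])
    qed
    then show "\<exists>g\<in>carrier G. \<forall>y\<in>D. the (\<theta> y) = g \<otimes> the (\<eta> y)"
      using cx by (intro bexI[of _ ?g]) auto
  qed
  then show "potential_class G X \<rho> \<theta> = potential_class G X \<rho> \<eta>"
    by (simp add: potential_class_eq_iff[OF p])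
qed

end


section \<open>Graphs and gain graphs\<close>

text \<open>An edge is a loop if its set of endpoints is a singleton; distinct edges may be parallel.\<close>

record ('v, 'e) ugraph =
  verts :: "'v set"
  edges :: "'e set"
  ends :: "'e \<Rightarrow> 'v set"

locale ugraph =
  fixes \<Gamma> :: "('v, 'e, 'k) ugraph_scheme"
  assumes ends_verts: "e \<in> edges \<Gamma> \<Longrightarrow> ends \<Gamma> e \<subseteq> verts \<Gamma>"
    and card_ends: "e \<in> edges \<Gamma> \<Longrightarrow> card (ends \<Gamma> e) = 1 \<or> card (ends \<Gamma> e) = 2"

definition orientation :: "('v, 'e, 'k) ugraph_scheme \<Rightarrow> ('e \<Rightarrow> 'v \<times> 'v) \<Rightarrow> bool" where
  "orientation \<Gamma> d \<longleftrightarrow> (\<forall>e\<in>edges \<Gamma>. ends \<Gamma> e = {fst (d e), snd (d e)})"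

definition complete_graph :: "'v set \<Rightarrow> ('v, 'v set) ugraph" where
  "complete_graph X = \<lparr>verts = X, edges = {e. e \<subseteq> X \<and> card e = 2}, ends = (\<lambda>e. e)\<rparr>"

text \<open>
  An oriented edge is a pair \<open>(e, b)\<close>: \<open>e\<close> in its reference direction \<open>ref_dir e\<close> if \<open>b\<close>
  holds and in the opposite direction otherwise. Naming the direction by a truth value, and not by
  the pair of initial and terminal vertex, keeps the two orientations of a loop apart.
\<close>

record ('v, 'e, 'g) gain_graph = "('v, 'e) ugraph" +
  ref_dir :: "'e \<Rightarrow> 'v \<times> 'v"
  gain :: "'e \<times> bool \<Rightarrow> 'g"

locale gain_graph = group G + ugraph \<Phi>
  for G :: "('g, 'm) monoid_scheme" (structure) and \<Phi> :: "('v, 'e, 'g, 'k) gain_graph_scheme" +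
  assumes ref_dir: "orientation \<Phi> (ref_dir \<Phi>)"
    and gain_closed: "e \<in> edges \<Phi> \<Longrightarrow> gain \<Phi> (e, b) \<in> carrier G"
    and gain_reverse: "e \<in> edges \<Phi> \<Longrightarrow> gain \<Phi> (e, \<not> b) = inv (gain \<Phi> (e, b))"

definition initial :: "('v, 'e, 'g, 'k) gain_graph_scheme \<Rightarrow> 'e \<times> bool \<Rightarrow> 'v" where
  "initial \<Phi> = (\<lambda>(e, b). if b then fst (ref_dir \<Phi> e) else snd (ref_dir \<Phi> e))"

definition terminal :: "('v, 'e, 'g, 'k) gain_graph_scheme \<Rightarrow> 'e \<times> bool \<Rightarrow> 'v" where
  "terminal \<Phi> = (\<lambda>(e, b). if b then snd (ref_dir \<Phi> e) else fst (ref_dir \<Phi> e))"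

definition path_gain ::
    "('g, 'm) monoid_scheme \<Rightarrow> ('v, 'e, 'g, 'k) gain_graph_scheme \<Rightarrow> ('e \<times> bool) list \<Rightarrow> 'g" where
  "path_gain G \<Phi> p = foldr (\<lambda>a z. gain \<Phi> a \<otimes>\<^bsub>G\<^esub> z) p \<one>\<^bsub>G\<^esub>"

text \<open>
  Distinctness of the edges only matters for closed paths of length two, where it excludes
  running forth and back along one edge.
\<close>

definition simple_closed_path ::
    "('v, 'e, 'g, 'k) gain_graph_scheme \<Rightarrow> ('e \<times> bool) list \<Rightarrow> bool" where
  "simple_closed_path \<Phi> p \<longleftrightarrow>
     p \<noteq> [] \<and> fst ` set p \<subseteq> edges \<Phi> \<and>
     (\<forall>i<length p. terminal \<Phi> (p ! i) = initial \<Phi> (p ! (Suc i mod length p))) \<and>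
     distinct (map (initial \<Phi>) p) \<and> distinct (map fst p)"

text \<open>A subgraph is the pair of its vertex set and its edge set.\<close>

type_synonym ('v, 'e) sub = "'v set \<times> 'e set"

definition subgraph :: "('v, 'e, 'k) ugraph_scheme \<Rightarrow> ('v, 'e) sub \<Rightarrow> bool" where
  "subgraph \<Gamma> = (\<lambda>(V, E). V \<subseteq> verts \<Gamma> \<and> E \<subseteq> edges \<Gamma> \<and> (\<forall>e\<in>E. ends \<Gamma> e \<subseteq> V))"

definition sub_le :: "('v, 'e) sub \<Rightarrow> ('v, 'e) sub \<Rightarrow> bool" where
  "sub_le A B \<longleftrightarrow> fst A \<subseteq> fst B \<and> snd A \<subseteq> snd B"

definition sub_inter :: "('v, 'e) sub \<Rightarrow> ('v, 'e) sub \<Rightarrow> ('v, 'e) sub" where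
  "sub_inter A B = (fst A \<inter> fst B, snd A \<inter> snd B)"

definition delete_edge :: "('v, 'e) sub \<Rightarrow> 'e \<Rightarrow> ('v, 'e) sub" where
  "delete_edge A e = (fst A, snd A - {e})"

definition path_graph ::
    "('v, 'e, 'g, 'k) gain_graph_scheme \<Rightarrow> ('e \<times> bool) list \<Rightarrow> ('v, 'e) sub" where
  "path_graph \<Phi> p = (initial \<Phi> ` set p, fst ` set p)"

definition circle :: "('v, 'e, 'g, 'k) gain_graph_scheme \<Rightarrow> ('v, 'e) sub \<Rightarrow> bool" where
  "circle \<Phi> C \<longleftrightarrow> (\<exists>p. simple_closed_path \<Phi> p \<and> C = path_graph \<Phi> p)"

text \<open>
  Representations of a circle as a closed path differ by the starting point and the direction,
  which conjugates or inverts the gain, so gain \<open>\<one>\<close> for one of them is gain \<open>\<one>\<close> for all.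
\<close>

definition balanced_circle ::
    "('g, 'm) monoid_scheme \<Rightarrow> ('v, 'e, 'g, 'k) gain_graph_scheme \<Rightarrow> ('v, 'e) sub \<Rightarrow> bool" where
  "balanced_circle G \<Phi> C \<longleftrightarrow> circle \<Phi> C \<and>
     (\<forall>p. simple_closed_path \<Phi> p \<and> path_graph \<Phi> p = C \<longrightarrow> path_gain G \<Phi> p = \<one>\<^bsub>G\<^esub>)"

definition balanced ::
    "('g, 'm) monoid_scheme \<Rightarrow> ('v, 'e, 'g, 'k) gain_graph_scheme \<Rightarrow> ('v, 'e) sub \<Rightarrow> bool" where
  "balanced G \<Phi> \<Upsilon> \<longleftrightarrow> (\<forall>C. circle \<Phi> C \<and> sub_le C \<Upsilon> \<longrightarrow> balanced_circle G \<Phi> C)"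

definition closed_balanced ::
    "('g, 'm) monoid_scheme \<Rightarrow> ('v, 'e, 'g, 'k) gain_graph_scheme \<Rightarrow> ('v, 'e) sub \<Rightarrow> bool" where
  "closed_balanced G \<Phi> \<Upsilon> \<longleftrightarrow> balanced G \<Phi> \<Upsilon> \<and>
     (\<forall>C e. balanced_circle G \<Phi> C \<and> e \<in> snd C \<and> sub_le (delete_edge C e) \<Upsilon> \<longrightarrow> e \<in> snd \<Upsilon>)"

definition graphic_rhodes ::
    "('g, 'm) monoid_scheme \<Rightarrow> ('v, 'e, 'g, 'k) gain_graph_scheme \<Rightarrow> ('v, 'e) sub meet_gorder" where
  "graphic_rhodes G \<Phi> =
     \<lparr>carrier = {\<Upsilon>. subgraph \<Phi> \<Upsilon> \<and> closed_balanced G \<Phi> \<Upsilon>}, eq = (=),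
      le = sub_le, wedge = sub_inter\<rparr>"


section \<open>Group expansions\<close>

definition group_expansion ::
    "('g, 'm) monoid_scheme \<Rightarrow> ('v, 'e) ugraph \<Rightarrow> ('e \<Rightarrow> 'v \<times> 'v) \<Rightarrow> ('v, 'g \<times> 'e, 'g) gain_graph" where
  "group_expansion G \<Gamma> d =
     \<lparr>verts = verts \<Gamma>, edges = carrier G \<times> edges \<Gamma>, ends = (\<lambda>(g, e). ends \<Gamma> e),
      ref_dir = (\<lambda>(g, e). d e),
      gain = (\<lambda>((g, e), b). if b then g else inv\<^bsub>G\<^esub> g)\<rparr>"

lemma ugraph_complete_graph: "ugraph (complete_graph X)"
  by unfold_locales (auto simp: complete_graph_def)

lemma gain_graph_group_expansion:
  assumes "group G" "ugraph \<Gamma>" "orientation \<Gamma> d"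
  shows "gain_graph G (group_expansion G \<Gamma> d)"
proof -
  interpret group G by fact
  interpret \<Gamma>: ugraph \<Gamma> by fact
  show ?thesis
  proof
    show "orientation (group_expansion G \<Gamma> d) (ref_dir (group_expansion G \<Gamma> d))"
      using assms(3) by (auto simp: group_expansion_def orientation_def)
  qed (use \<Gamma>.ends_verts \<Gamma>.card_ends in \<open>auto simp: group_expansion_def\<close>)
qed

end

theory Submission
  imports Defs
begin

text \<open>
  A pair \<open>(\<pi>, [\<theta>])\<close> corresponds to the subgraph on \<open>supp \<pi>\<close> whose edges from \<open>x\<close> to \<open>y\<close> are
  those inside a block of \<open>\<pi>\<close> with gain \<open>\<theta>(x)\<inverse>\<theta>(y)\<close>. Gains of paths telescope, so this
  subgraph is closed and balanced. Conversely, balance of digons makes the gain between two vertices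
  of a closed balanced subgraph unique, and closure under balanced triangles makes adjacency
  transitive with multiplicative gains; hence the gains from a chosen root in each component form
  a potential. Order and meet are carried over edge by edge.
\<close>

section \<open>Transport of a meet-semilattice\<close>

text \<open>Lets the axioms be checked only on the side where meets are intersections. Antisymmetry
  comes from injectivity of \<open>f\<close>; since \<open>f\<close> preserves and reflects the
  order and respects \<open>wedge\<close>, the greatest lower bound of the images pulls
  back.\<close>

lemma meet_semilattice_transport:
  fixes S :: "'a meet_gorder" and T :: "'b meet_gorder"
  assumes T: "meet_semilattice T" "eq T = (=)" and S: "eq S = (=)"
    and bij: "bij_betw f (carrier S) (carrier T)"
    and le: "\<And>x y. x \<in> carrier S \<Longrightarrow> y \<in> carrier S \<Longrightarrow> x \<sqsubseteq>\<^bsub>S\<^esub> y \<longleftrightarrow> f x \<sqsubseteq>\<^bsub>T\<^esub> f y"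
    and closed: "\<And>x y. x \<in> carrier S \<Longrightarrow> y \<in> carrier S \<Longrightarrow> x \<triangle>\<^bsub>S\<^esub> y \<in> carrier S"
    and wedge: "\<And>x y. x \<in> carrier S \<Longrightarrow> y \<in> carrier S \<Longrightarrow> f (x \<triangle>\<^bsub>S\<^esub> y) = f x \<triangle>\<^bsub>T\<^esub> f y"
  shows "meet_semilattice S"
proof -
  interpret T: meet_semilattice T by fact
  have fT: "f x \<in> carrier T" if "x \<in> carrier S" for x
    using bij that by (rule bij_betwE[THEN bspec])
  have inj: "f x = f y \<Longrightarrow> x = y" if "x \<in> carrier S" "y \<in> carrier S" for x y
    using bij that by (meson bij_betw_imp_inj_on inj_onD)
  interpret S: partial_order S
  proof
    fix x y assume "x \<in> carrier S" "y \<in> carrier S" "x \<sqsubseteq>\<^bsub>S\<^esub> y" "y \<sqsubseteq>\<^bsub>S\<^esub> x"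
    then have "f x = f y" using le fT T.le_antisym T(2) by simp
    then show "x .=\<^bsub>S\<^esub> y" using inj T(2) S \<open>x \<in> carrier S\<close> \<open>y \<in> carrier S\<close> by simp
  next
    fix x y z assume *: "x \<in> carrier S" "y \<in> carrier S" "z \<in> carrier S"
      "x \<sqsubseteq>\<^bsub>S\<^esub> y" "y \<sqsubseteq>\<^bsub>S\<^esub> z"
    then have "f x \<sqsubseteq>\<^bsub>T\<^esub> f z" using T.le_trans[of "f x" "f y" "f z"] le fT by simp
    then show "x \<sqsubseteq>\<^bsub>S\<^esub> z" using le * by simp
  qed (use S le fT T.le_refl in auto)
  show ?thesis
  proof
    fix x y assume xy: "x \<in> carrier S" "y \<in> carrier S"
    have gr: "greatest T (f x \<triangle>\<^bsub>T\<^esub> f y) (Lower T {f x, f y})"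
      using T.wedge_greatest xy fT by simp
    have "f x \<triangle>\<^bsub>T\<^esub> f y \<in> Lower T {f x, f y}" using gr by (simp add: greatest_def)
    then have lower: "f (x \<triangle>\<^bsub>S\<^esub> y) \<sqsubseteq>\<^bsub>T\<^esub> f x" "f (x \<triangle>\<^bsub>S\<^esub> y) \<sqsubseteq>\<^bsub>T\<^esub> f y"
      using fT xy wedge by (auto simp: Lower_def)
    have above: "f z \<sqsubseteq>\<^bsub>T\<^esub> f (x \<triangle>\<^bsub>S\<^esub> y)"
      if "z \<in> carrier S" "f z \<sqsubseteq>\<^bsub>T\<^esub> f x" "f z \<sqsubseteq>\<^bsub>T\<^esub> f y" for z
      using gr that fT xy wedge by (auto simp: greatest_def Lower_def)
    show "greatest S (x \<triangle>\<^bsub>S\<^esub> y) (Lower S {x, y})"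
      using lower above xy le closed by (auto simp: greatest_def Lower_def)
  qed
qed

text \<open>A subgraph lies in an intersection iff it lies in both parts. Applied to a circle this
  gives balance of the intersection, and applied to a circle with one edge deleted it gives
  closure.\<close>

lemma meet_semilattice_graphic_rhodes: "meet_semilattice (graphic_rhodes G \<Phi>)"
proof
  fix A B
  assume A: "A \<in> carrier (graphic_rhodes G \<Phi>)" and B: "B \<in> carrier (graphic_rhodes G \<Phi>)"
  have sub: "sub_le C (sub_inter A B) \<longleftrightarrow> sub_le C A \<and> sub_le C B" for C
    by (auto simp: sub_le_def sub_inter_def)
  have lower: "sub_le (sub_inter A B) A" "sub_le (sub_inter A B) B"
    by (simp_all add: sub_le_def sub_inter_def)
  have "subgraph \<Phi> (sub_inter A B)"
    using A B by (auto simp: graphic_rhodes_def subgraph_def sub_inter_def split_beta)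
  moreover have "closed_balanced G \<Phi> (sub_inter A B)"
    using A B sub unfolding graphic_rhodes_def closed_balanced_def balanced_def
    by (auto simp: sub_inter_def)
  ultimately have "sub_inter A B \<in> carrier (graphic_rhodes G \<Phi>)"
    by (simp add: graphic_rhodes_def)
  then show "greatest (graphic_rhodes G \<Phi>) (A \<triangle>\<^bsub>graphic_rhodes G \<Phi>\<^esub> B)
      (Lower (graphic_rhodes G \<Phi>) {A, B})"
    using A B lower
    by (auto simp: greatest_def Lower_def graphic_rhodes_def sub simp del: split_paired_All)
qed (auto simp: graphic_rhodes_def sub_le_def prod_eq_iff)

section \<open>Walks and potentials\<close>

text \<open>Only incidence is recorded, with explicit end vertices; this is the form in which gains
  telescope by induction on the list.\<close>

fun walk :: "('v, 'e, 'g, 'k) gain_graph_scheme \<Rightarrow> 'v \<Rightarrow> ('e \<times> bool) list \<Rightarrow> 'v \<Rightarrow> bool" where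
  "walk \<Phi> u [] v \<longleftrightarrow> u = v"
| "walk \<Phi> u (a # p) v \<longleftrightarrow> initial \<Phi> a = u \<and> walk \<Phi> (terminal \<Phi> a) p v"

text \<open>Both lists enumerate the vertices visited, once read off from the ends and once from the
  beginnings of the edges.\<close>

lemma walk_iff_map: "walk \<Phi> u p v \<longleftrightarrow> u # map (terminal \<Phi>) p = map (initial \<Phi>) p @ [v]"
  by (induction p arbitrary: u) auto

lemma path_gain_Cons: "path_gain G \<Phi> (a # p) = gain \<Phi> a \<otimes>\<^bsub>G\<^esub> path_gain G \<Phi> p"
  by (simp add: path_gain_def)

text \<open>The successor index modulo the length is a cyclic shift. As a list equation the
  condition can be evaluated on explicit digons and triangles and compared with
  \<open>walk_iff_map\<close>.\<close>

lemma simple_closed_path_iff_rotate1: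
  "simple_closed_path \<Phi> p \<longleftrightarrow>
     p \<noteq> [] \<and> fst ` set p \<subseteq> edges \<Phi> \<and> map (terminal \<Phi>) p = rotate1 (map (initial \<Phi>) p) \<and>
     distinct (map (initial \<Phi>) p) \<and> distinct (map fst p)"
proof -
  have "(\<forall>i<length p. terminal \<Phi> (p ! i) = initial \<Phi> (p ! (Suc i mod length p))) \<longleftrightarrow>
      map (terminal \<Phi>) p = rotate1 (map (initial \<Phi>) p)"
    by (cases "p = []") (simp_all add: list_eq_iff_nth_eq[of "map (terminal \<Phi>) p"] nth_rotate1)
  then show ?thesis by (simp add: simple_closed_path_def)
qed

text \<open>Used to bring a chosen edge of a circle to the front of its closed path.\<close>

lemma simple_closed_path_rotate:
  "simple_closed_path \<Phi> p \<Longrightarrow> simple_closed_path \<Phi> (rotate k p)"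
proof (induction k)
  case (Suc k)
  then show ?case
    by (simp add: simple_closed_path_iff_rotate1 rotate1_map)
      (simp flip: rotate1_map)
qed simp

lemma path_graph_rotate [simp]: "path_graph \<Phi> (rotate k p) = path_graph \<Phi> p"
  by (simp add: path_graph_def)

text \<open>The cyclic shift of the initial vertices of \<open>a # p\<close> is
  \<open>map (initial \<Phi>) p @ [initial \<Phi> a]\<close>, so the closing condition is literally
  the equation of \<open>walk_iff_map\<close>.\<close>

lemma simple_closed_path_walk:
  "simple_closed_path \<Phi> (a # p) \<Longrightarrow> walk \<Phi> (terminal \<Phi> a) p (initial \<Phi> a)"
  by (simp add: simple_closed_path_iff_rotate1 walk_iff_map)

text \<open>Each edge has both ends in one block; by disjointness this is the block already
  reached.\<close>

lemma walk_in_block: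
  assumes "walk \<Phi> u p v" "disjoint \<pi>" "B \<in> \<pi>" "u \<in> B"
    and "\<And>a. a \<in> set p \<Longrightarrow> \<exists>C\<in>\<pi>. initial \<Phi> a \<in> C \<and> terminal \<Phi> a \<in> C"
  shows "v \<in> B"
  using assms
proof (induction p arbitrary: u)
  case (Cons a p)
  then obtain C where C: "C \<in> \<pi>" "initial \<Phi> a \<in> C" "terminal \<Phi> a \<in> C"
    using Cons.prems(5)[of a] by auto
  then have "C = B" using Cons.prems disjoint_block_eq[of \<pi> C B u] by auto
  then show ?case using Cons.IH[of "terminal \<Phi> a"] Cons.prems C by auto
qed simp

text \<open>The function \<open>f\<close> is total and constrained only at the two ends of the edge,
  so that partial potentials (via \<open>the\<close>) and auxiliary functions on a few vertices are
  treated alike.\<close>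

definition potential_gain ::
    "('g, 'm) monoid_scheme \<Rightarrow> ('v, 'e, 'g, 'k) gain_graph_scheme \<Rightarrow> ('v \<Rightarrow> 'g) \<Rightarrow> 'e \<times> bool \<Rightarrow> bool"
  where
  "potential_gain G \<Phi> f a \<longleftrightarrow>
     f (initial \<Phi> a) \<in> carrier G \<and> f (terminal \<Phi> a) \<in> carrier G \<and>
     gain \<Phi> a = inv\<^bsub>G\<^esub> f (initial \<Phi> a) \<otimes>\<^bsub>G\<^esub> f (terminal \<Phi> a)"

context group
begin

lemma inv_mult_cancel:
  "a \<in> carrier G \<Longrightarrow> b \<in> carrier G \<Longrightarrow> c \<in> carrier G \<Longrightarrow>
    (inv a \<otimes> b) \<otimes> (inv b \<otimes> c) = inv a \<otimes> c"
  by (metis inv_closed m_assoc m_closed r_inv r_one)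

text \<open>Each intermediate vertex cancels by \<open>inv_mult_cancel\<close>. For the empty walk,
  \<open>f u \<in> carrier G\<close> makes the right-hand side equal to
  \<open>\<one>\<close>.\<close>

lemma path_gain_telescope:
  assumes "walk \<Phi> u p v" "f u \<in> carrier G" "\<And>a. a \<in> set p \<Longrightarrow> potential_gain G \<Phi> f a"
  shows "f v \<in> carrier G \<and> path_gain G \<Phi> p = inv (f u) \<otimes> f v"
  using assms
proof (induction p arbitrary: u)
  case Nil
  then show ?case by (simp add: path_gain_def)
next
  case (Cons a p)
  have a: "potential_gain G \<Phi> f a" "initial \<Phi> a = u" using Cons.prems by simp_all
  then have "f v \<in> carrier G \<and> path_gain G \<Phi> p = inv (f (terminal \<Phi> a)) \<otimes> f v"
    using Cons.IH[of "terminal \<Phi> a"] Cons.prems by (simp add: potential_gain_def)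
  then show ?case using a inv_mult_cancel by (simp add: path_gain_Cons potential_gain_def)
qed

text \<open>Along any closed path the gain telescopes to
  \<open>inv (f v) \<otimes> f v = \<one>\<close>. Both directions of an edge are assumed to follow
  \<open>f\<close>, since a representation may traverse the circle either way.\<close>

lemma balanced_circle_if_potential:
  assumes "circle \<Phi> C" "\<And>e b. e \<in> snd C \<Longrightarrow> potential_gain G \<Phi> f (e, b)"
  shows "balanced_circle G \<Phi> C"
  unfolding balanced_circle_def
proof (intro conjI allI impI)
  fix p assume p: "simple_closed_path \<Phi> p \<and> path_graph \<Phi> p = C"
  then obtain a q where aq: "p = a # q" by (cases p) (auto simp: simple_closed_path_def)
  have pot: "potential_gain G \<Phi> f c" if "c \<in> set p" for c
    using assms(2)[of "fst c" "snd c"] p that by (auto simp: path_graph_def)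
  have "walk \<Phi> (initial \<Phi> a) p (initial \<Phi> a)"
    using p simple_closed_path_walk aq by fastforce
  moreover have "f (initial \<Phi> a) \<in> carrier G" using pot aq by (simp add: potential_gain_def)
  ultimately show "path_gain G \<Phi> p = \<one>" using path_gain_telescope[of \<Phi> _ p _ f] pot by simp
qed fact

end

section \<open>Edges of the expanded complete graph\<close>

locale complete_expansion = group G
  for G :: "('g, 'm) monoid_scheme" (structure) +
  fixes X :: "'x set" and d :: "'x set \<Rightarrow> 'x \<times> 'x"
  assumes orient: "orientation (complete_graph X) d"
begin

abbreviation "expansion \<equiv> group_expansion G (complete_graph X) d"

text \<open>Hides the arbitrary orientation \<open>d\<close>: for distinct \<open>x\<close>,
  \<open>y\<close> in \<open>X\<close> this is the oriented edge from \<open>x\<close> to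
  \<open>y\<close> with gain \<open>g\<close>. An edge is labelled by its gain in the direction of
  \<open>d\<close>, hence the inverse when \<open>d\<close> runs from \<open>y\<close> to
  \<open>x\<close>.\<close>

definition arc :: "'x \<Rightarrow> 'g \<Rightarrow> 'x \<Rightarrow> ('g \<times> 'x set) \<times> bool" where
  "arc x g y = (let b = (d {x, y} = (x, y)) in ((if b then g else inv g, {x, y}), b))"

abbreviation edge :: "'x \<Rightarrow> 'g \<Rightarrow> 'x \<Rightarrow> 'g \<times> 'x set" where
  "edge x g y \<equiv> fst (arc x g y)"

lemma edges_expansion: "edges expansion = carrier G \<times> {e. e \<subseteq> X \<and> card e = 2}"
  by (simp add: group_expansion_def complete_graph_def)

lemma d_cases:
  assumes "x \<in> X" "y \<in> X" "x \<noteq> y"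
  shows "d {x, y} = (x, y) \<or> d {x, y} = (y, x)"
proof -
  have "{x, y} = {fst (d {x, y}), snd (d {x, y})}"
    using orient assms by (auto simp: orientation_def complete_graph_def)
  then show ?thesis by (cases "d {x, y}") (auto simp: doubleton_eq_iff)
qed

lemma arc_props:
  assumes "x \<in> X" "y \<in> X" "x \<noteq> y" "g \<in> carrier G"
  shows "edge x g y \<in> edges expansion" "initial expansion (arc x g y) = x"
    "terminal expansion (arc x g y) = y" "gain expansion (arc x g y) = g"
    "snd (edge x g y) = {x, y}"
  using d_cases[OF assms(1-3)] assms
  by (auto simp: arc_def Let_def group_expansion_def complete_graph_def initial_def terminal_def)

text \<open>One of the two descriptions follows \<open>d\<close> and the other opposes it, so both
  carry the same label.\<close>

lemma edge_flip:
  assumes "x \<in> X" "y \<in> X" "x \<noteq> y" "g \<in> carrier G"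
  shows "edge y (inv g) x = edge x g y"
  using d_cases[OF assms(1-3)] assms by (auto simp: arc_def Let_def insert_commute)

lemma arc_cases:
  assumes "fst a \<in> edges expansion"
  obtains x y g where "x \<in> X" "y \<in> X" "x \<noteq> y" "g \<in> carrier G" "a = arc x g y"
proof -
  obtain k e b where a: "a = ((k, e), b)" by (metis prod.exhaust)
  then have k: "k \<in> carrier G" and e: "e \<subseteq> X" "card e = 2"
    using assms by (simp_all add: edges_expansion)
  obtain u v where uv: "e = {u, v}" "u \<noteq> v" using e by (meson card_2_iff)
  have *: "\<exists>x y. x \<in> X \<and> y \<in> X \<and> x \<noteq> y \<and> e = {x, y} \<and> d e = (x, y)"
    using d_cases[of u v] uv e by (metis insert_commute insert_subset)
  then obtain x y where xy: "x \<in> X" "y \<in> X" "x \<noteq> y" "e = {x, y}" "d e = (x, y)" by blast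
  show ?thesis
  proof (cases b)
    case True
    then have "a = arc x k y" using a xy by (simp add: arc_def)
    then show ?thesis using that xy k by blast
  next
    \<comment> \<open>Against the reference direction the arc starts at \<open>y\<close> with gain
      \<open>inv k\<close>, which \<open>arc\<close> inverts back to the label
      \<open>k\<close>.\<close>
    case False
    have "{y, x} = {x, y}" by blast
    then have "a = arc y (inv k) x" using a xy k False by (simp add: arc_def)
    then show ?thesis using that xy k by (metis inv_closed)
  qed
qed

lemma edge_cases:
  assumes "e \<in> edges expansion"
  obtains x y g where "x \<in> X" "y \<in> X" "x \<noteq> y" "g \<in> carrier G" "e = edge x g y"
  using arc_cases[of "(e, True)"] assms by (metis fst_conv)

lemma edge_gain_unique:
  assumes "x \<in> X" "y \<in> X" "x \<noteq> y" "g \<in> carrier G" "h \<in> carrier G" "edge x g y = edge x h y"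
  shows "g = h"
  using assms by (auto simp: arc_def Let_def split: if_splits) (metis inv_inv)

lemma potential_gain_arc:
  assumes "x \<in> X" "y \<in> X" "x \<noteq> y" "g \<in> carrier G" "f x \<in> carrier G" "f y \<in> carrier G"
    and g: "g = inv (f x) \<otimes> f y"
  shows "potential_gain G expansion f (edge x g y, b)"
proof -
  have "inv (inv (f x) \<otimes> f y) = inv (f y) \<otimes> f x" "inv (inv (f y) \<otimes> f x) = inv (f x) \<otimes> f y"
    using assms by (simp_all add: inv_mult_group)
  \<comment> \<open>The flag \<open>b\<close> means the direction from \<open>x\<close> to
    \<open>y\<close> exactly when it equals the truth value of
    \<open>d {x, y} = (x, y)\<close>.\<close>
  then have *: "gain expansion (edge x g y, b) =
      (if b = (d {x, y} = (x, y)) then inv (f x) \<otimes> f y else inv (f y) \<otimes> f x)"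
    using assms by (auto simp: arc_def Let_def group_expansion_def)
  show ?thesis
    using d_cases[OF assms(1-3)] assms(1-6) *
    by (auto simp: potential_gain_def arc_def Let_def group_expansion_def initial_def terminal_def)
qed

section \<open>The subgraph of a partition with a potential\<close>

text \<open>A left factor on a block cancels in the quotients, so the potential matters only up to
  equivalence. The pairs \<open>(x, y)\<close> and \<open>(y, x)\<close> describe the same edge,
  with inverse gains.\<close>

definition pot_graph :: "'x set set \<Rightarrow> ('x \<rightharpoonup> 'g) \<Rightarrow> ('x, 'g \<times> 'x set) sub" where
  "pot_graph \<pi> \<theta> = (supp \<pi>,
     {e. \<exists>B\<in>\<pi>. \<exists>x\<in>B. \<exists>y\<in>B. x \<noteq> y \<and> e = edge x (inv (the (\<theta> x)) \<otimes> the (\<theta> y)) y})"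

lemma partial_partitionD:
  assumes "partial_partition X \<pi>"
  shows "disjoint \<pi>" "supp \<pi> \<subseteq> X" "{} \<notin> \<pi>"
  using assms by (auto simp: partial_partition_def partition_on_def)

text \<open>The edge may have been listed from either end. Its set of ends leaves two cases; in the
  reversed one \<open>edge_flip\<close> inverts the gain.\<close>

lemma mem_pot_graph:
  assumes "partial_partition X \<pi>" "\<theta> \<in> potentials G X \<pi>"
    and "x \<in> X" "y \<in> X" "x \<noteq> y" "g \<in> carrier G"
  shows "edge x g y \<in> snd (pot_graph \<pi> \<theta>) \<longleftrightarrow>
    (\<exists>B\<in>\<pi>. x \<in> B \<and> y \<in> B \<and> g = inv (the (\<theta> x)) \<otimes> the (\<theta> y))"
proof
  assume "edge x g y \<in> snd (pot_graph \<pi> \<theta>)"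
  then obtain B u v where B: "B \<in> \<pi>" "u \<in> B" "v \<in> B" "u \<noteq> v"
    and e: "edge x g y = edge u (inv (the (\<theta> u)) \<otimes> the (\<theta> v)) v"
    by (auto simp: pot_graph_def)
  let ?h = "inv (the (\<theta> u)) \<otimes> the (\<theta> v)"
  have c: "the (\<theta> u) \<in> carrier G" "the (\<theta> v) \<in> carrier G"
    using B assms(2) by (auto intro: potentials_carrier)
  have X: "u \<in> X" "v \<in> X" using B partial_partitionD(2)[OF assms(1)] by auto
  have "{x, y} = {u, v}" using e arc_props(5) assms X B c by (metis inv_closed m_closed)
  then consider "x = u" "y = v" | "x = v" "y = u" by (auto simp: doubleton_eq_iff)
  then show "\<exists>B\<in>\<pi>. x \<in> B \<and> y \<in> B \<and> g = inv (the (\<theta> x)) \<otimes> the (\<theta> y)"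
  proof cases
    case 1
    then have "g = ?h" using e c edge_gain_unique[OF X B(4), of g ?h] assms(6) by simp
    then show ?thesis using B 1 by blast
  next
    case 2
    have "edge u ?h v = edge v (inv ?h) u" using edge_flip[OF X B(4), of ?h] c by simp
    then have "g = inv ?h" using e c 2 edge_gain_unique[of v u g "inv ?h"] X B assms(6) by simp
    then have "g = inv (the (\<theta> v)) \<otimes> the (\<theta> u)" using c by (simp add: inv_mult_group)
    then show ?thesis using B 2 by blast
  qed
qed (use assms(5) in \<open>auto simp: pot_graph_def\<close>)

lemma pot_graph_edges:
  assumes "partial_partition X \<pi>" "\<theta> \<in> potentials G X \<pi>"
  shows "snd (pot_graph \<pi> \<theta>) \<subseteq> edges expansion"
proof
  fix e assume "e \<in> snd (pot_graph \<pi> \<theta>)"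
  then obtain B x y where *: "B \<in> \<pi>" "x \<in> B" "y \<in> B" "x \<noteq> y"
    "e = edge x (inv (the (\<theta> x)) \<otimes> the (\<theta> y)) y" by (auto simp: pot_graph_def)
  then show "e \<in> edges expansion"
    using partial_partitionD(2)[OF assms(1)] potentials_carrier[OF assms(2)]
    by (auto intro!: arc_props(1))
qed

text \<open>These are the hypotheses on edges of \<open>walk_in_block\<close> and
  \<open>path_gain_telescope\<close>.\<close>

lemma pot_graph_arc:
  assumes "partial_partition X \<pi>" "\<theta> \<in> potentials G X \<pi>" "fst a \<in> snd (pot_graph \<pi> \<theta>)"
  shows "\<exists>B\<in>\<pi>. initial expansion a \<in> B \<and> terminal expansion a \<in> B"
    and "potential_gain G expansion (\<lambda>x. the (\<theta> x)) a"
proof -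
  have "fst a \<in> edges expansion" using pot_graph_edges assms by blast
  then obtain x y g where a: "x \<in> X" "y \<in> X" "x \<noteq> y" "g \<in> carrier G" "a = arc x g y"
    by (rule arc_cases)
  then obtain B where "B \<in> \<pi>" "x \<in> B" "y \<in> B" "g = inv (the (\<theta> x)) \<otimes> the (\<theta> y)"
    using assms mem_pot_graph[OF assms(1,2) a(1-4)] by blast
  then show "\<exists>B\<in>\<pi>. initial expansion a \<in> B \<and> terminal expansion a \<in> B"
    and "potential_gain G expansion (\<lambda>x. the (\<theta> x)) a"
    using a potentials_carrier[OF assms(2)] by (auto simp: arc_props potential_gain_def)
qed

lemma subgraph_pot_graph:
  assumes "partial_partition X \<pi>" "\<theta> \<in> potentials G X \<pi>"
  shows "subgraph expansion (pot_graph \<pi> \<theta>)"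
proof -
  have "ends expansion e \<subseteq> supp \<pi>" if e: "e \<in> snd (pot_graph \<pi> \<theta>)" for e
  proof -
    obtain x y g where a: "x \<in> X" "y \<in> X" "x \<noteq> y" "g \<in> carrier G" "e = edge x g y"
      using e pot_graph_edges[OF assms] edge_cases by blast
    then have "ends expansion e = {x, y}"
      using arc_props(5)[OF a(1-4)] by (simp add: group_expansion_def complete_graph_def split_beta)
    then show ?thesis using e a(5) mem_pot_graph[OF assms a(1-4)] by auto
  qed
  moreover have "verts expansion = X" by (simp add: group_expansion_def complete_graph_def)
  ultimately show ?thesis
    using pot_graph_edges[OF assms] partial_partitionD(2)[OF assms(1)]
    by (auto simp: subgraph_def pot_graph_def)
qed

text \<open>Balance is telescoping. For closure, the circle without \<open>e\<close> is a walk in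
  the subgraph joining the ends of \<open>e\<close>; hence these ends share a block, the gain of the
  walk is a quotient of the potential, and balance forces the gain of \<open>e\<close> to be its
  inverse.\<close>

lemma closed_balanced_pot_graph:
  assumes "partial_partition X \<pi>" "\<theta> \<in> potentials G X \<pi>"
  shows "closed_balanced G expansion (pot_graph \<pi> \<theta>)"
  unfolding closed_balanced_def
proof (intro conjI allI impI)
  let ?f = "\<lambda>x. the (\<theta> x)"
  show "balanced G expansion (pot_graph \<pi> \<theta>)"
    unfolding balanced_def
  proof (intro allI impI)
    fix C assume C: "circle expansion C \<and> sub_le C (pot_graph \<pi> \<theta>)"
    show "balanced_circle G expansion C"
    proof (rule balanced_circle_if_potential)
      fix e b assume "e \<in> snd C"
      then show "potential_gain G expansion ?f (e, b)"
        using C pot_graph_arc(2)[OF assms, of "(e, b)"] by (auto simp: sub_le_def)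
    qed (use C in blast)
  qed
  fix C e
  assume "balanced_circle G expansion C \<and> e \<in> snd C \<and> sub_le (delete_edge C e) (pot_graph \<pi> \<theta>)"
  then have C: "balanced_circle G expansion C" "e \<in> snd C"
    and le: "snd C - {e} \<subseteq> snd (pot_graph \<pi> \<theta>)"
    by (auto simp: sub_le_def delete_edge_def)
  obtain p where p: "simple_closed_path expansion p" "C = path_graph expansion p"
    using C by (auto simp: balanced_circle_def circle_def)
  obtain k where k: "k < length p" "e = fst (p ! k)"
    using C(2) p(2) by (auto simp: path_graph_def in_set_conv_nth)
  \<comment> \<open>The closed path is rotated to start with the deleted edge; \<open>q\<close> is
    the rest of the circle.\<close>
  define q where "q = tl (rotate k p)"
  let ?a = "p ! k"
  have "rotate k p \<noteq> []" using k by auto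
  then have rot: "rotate k p = ?a # q"
    using k by (metis hd_Cons_tl hd_rotate_conv_nth list.size(3) mod_less not_less0 q_def)
  have scp: "simple_closed_path expansion (?a # q)" and pg: "path_graph expansion (?a # q) = C"
    using simple_closed_path_rotate[OF p(1), of k] path_graph_rotate[of expansion k p] p(2) rot
    by simp_all
  then have gain1: "gain expansion ?a \<otimes> path_gain G expansion q = \<one>"
    using C(1) by (auto simp: balanced_circle_def path_gain_Cons)
  have "fst ?a \<in> edges expansion" using scp by (simp add: simple_closed_path_def)
  then obtain x y g where a: "x \<in> X" "y \<in> X" "x \<noteq> y" "g \<in> carrier G" "?a = arc x g y"
    by (rule arc_cases)
  have walk: "walk expansion y q x"
    using simple_closed_path_walk[OF scp] a by (simp add: arc_props)
  \<comment> \<open>The edges of a simple closed path are distinct, so \<open>e\<close> does not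
    recur in \<open>q\<close>.\<close>
  have q: "fst c \<in> snd (pot_graph \<pi> \<theta>)" if "c \<in> set q" for c
  proof -
    have "fst ?a \<notin> fst ` set q" using scp by (simp add: simple_closed_path_iff_rotate1)
    then have "fst c \<noteq> e" using that k(2) by (metis imageI)
    moreover have "fst c \<in> snd C" using that pg by (auto simp: path_graph_def)
    ultimately show ?thesis using le by blast
  qed
  \<comment> \<open>As \<open>x \<noteq> y\<close>, the walk is nonempty, and its first edge places
    \<open>y\<close> in a block.\<close>
  obtain c q' where cq: "q = c # q'" using walk a(3) by (cases q) auto
  then obtain B where B: "B \<in> \<pi>" "y \<in> B"
    using pot_graph_arc(1)[OF assms q[of c]] walk by auto
  have xB: "x \<in> B"
    using walk_in_block[OF walk partial_partitionD(1)[OF assms(1)] B]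
      pot_graph_arc(1)[OF assms q] by blast
  have c: "?f x \<in> carrier G" "?f y \<in> carrier G" using potentials_carrier[OF assms(2)] B xB by auto
  have "path_gain G expansion q = inv (?f y) \<otimes> ?f x"
    using path_gain_telescope[OF walk, of ?f] c pot_graph_arc(2)[OF assms q] by blast
  then have "g = inv (inv (?f y) \<otimes> ?f x)"
    using gain1 a c arc_props(4)[OF a(1-4)] inv_equality[of g "inv (?f y) \<otimes> ?f x"] by simp
  then have "g = inv (?f x) \<otimes> ?f y" using c by (simp add: inv_mult_group)
  then show "e \<in> snd (pot_graph \<pi> \<theta>)"
    using mem_pot_graph[OF assms a(1-4)] B xB k(2) a(5) by auto
qed

text \<open>From right to left, equivalent potentials have equal quotients inside a block of
  \<open>\<tau>\<close>. From left to right, fix \<open>x\<close> in such a block: the edges from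
  \<open>x\<close> to the other vertices of the block lie in the larger subgraph, which gives a
  common block of \<open>\<pi>\<close> and equal quotients.\<close>

lemma sub_le_pot_graph_iff:
  assumes \<tau>: "partial_partition X \<tau>" "\<eta> \<in> potentials G X \<tau>"
    and \<pi>: "partial_partition X \<pi>" "\<theta> \<in> potentials G X \<pi>"
  shows "sub_le (pot_graph \<tau> \<eta>) (pot_graph \<pi> \<theta>) \<longleftrightarrow>
    refining \<tau> \<pi> \<and> potential_class G X \<tau> \<eta> = potential_class G X \<tau> \<theta>"
proof
  assume *: "refining \<tau> \<pi> \<and> potential_class G X \<tau> \<eta> = potential_class G X \<tau> \<theta>"
  then have \<theta>\<tau>: "\<theta> \<in> potentials G X \<tau>"
    using potential_equiv_refining potential_equiv_refl \<pi>(2) by blast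
  then have eq: "potential_equiv G \<tau> \<eta> \<theta>" using * potential_class_eq_iff[OF \<tau>(2)] by blast
  show "sub_le (pot_graph \<tau> \<eta>) (pot_graph \<pi> \<theta>)"
    unfolding sub_le_def
  proof
    show "fst (pot_graph \<tau> \<eta>) \<subseteq> fst (pot_graph \<pi> \<theta>)"
      using * by (fastforce simp: pot_graph_def refining_def)
    show "snd (pot_graph \<tau> \<eta>) \<subseteq> snd (pot_graph \<pi> \<theta>)"
    proof
      fix e assume "e \<in> snd (pot_graph \<tau> \<eta>)"
      then obtain B x y where B: "B \<in> \<tau>" "x \<in> B" "y \<in> B" "x \<noteq> y"
        "e = edge x (inv (the (\<eta> x)) \<otimes> the (\<eta> y)) y" by (auto simp: pot_graph_def)
      moreover obtain C where "C \<in> \<pi>" "B \<subseteq> C" using * B(1) by (auto simp: refining_def)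
      ultimately show "e \<in> snd (pot_graph \<pi> \<theta>)"
        using quotient_potential_equiv[OF \<theta>\<tau> \<tau>(2) eq B(1-3)] by (auto simp: pot_graph_def)
    qed
  qed
next
  assume le: "sub_le (pot_graph \<tau> \<eta>) (pot_graph \<pi> \<theta>)"
  \<comment> \<open>A singleton block carries no edges; the vertex sets are what place it inside a
    block of \<open>\<pi>\<close>.\<close>
  then have "supp \<tau> \<subseteq> supp \<pi>" by (simp add: sub_le_def pot_graph_def)
  then have \<theta>\<tau>: "\<theta> \<in> potentials G X \<tau>" using \<pi>(2) unfolding potentials_def by blast
  have block: "\<exists>C\<in>\<pi>. B \<subseteq> C \<and> (\<exists>g\<in>carrier G. \<forall>y\<in>B. the (\<eta> y) = g \<otimes> the (\<theta> y))"
    if B: "B \<in> \<tau>" for B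
  proof -
    obtain x where x: "x \<in> B" using partial_partitionD(3)[OF \<tau>(1)] B by fastforce
    then obtain C where C: "C \<in> \<pi>" "x \<in> C" using \<open>supp \<tau> \<subseteq> supp \<pi>\<close> B by blast
    \<comment> \<open>The only translation that can work, read off at the base point
      \<open>x\<close>.\<close>
    let ?g = "the (\<eta> x) \<otimes> inv (the (\<theta> x))"
    have cx: "the (\<eta> x) \<in> carrier G" "the (\<theta> x) \<in> carrier G"
      using potentials_carrier[OF \<tau>(2) B x] potentials_carrier[OF \<theta>\<tau> B x] .
    have "y \<in> C \<and> the (\<eta> y) = ?g \<otimes> the (\<theta> y)" if y: "y \<in> B" for y
    proof (cases "y = x")
      case True
      then show ?thesis using C cx by (simp add: m_assoc)
    next
      case False
      have cy: "the (\<eta> y) \<in> carrier G" "the (\<theta> y) \<in> carrier G"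
        using potentials_carrier[OF \<tau>(2) B y] potentials_carrier[OF \<theta>\<tau> B y] .
      let ?h = "inv (the (\<eta> x)) \<otimes> the (\<eta> y)"
      have X: "x \<in> X" "y \<in> X" using B x y partial_partitionD(2)[OF \<tau>(1)] by auto
      have "edge x ?h y \<in> snd (pot_graph \<tau> \<eta>)"
        using mem_pot_graph[OF \<tau> X, of ?h] B x y False cx cy by auto
      then have "edge x ?h y \<in> snd (pot_graph \<pi> \<theta>)" using le by (auto simp: sub_le_def)
      then obtain C' where C': "C' \<in> \<pi>" "x \<in> C'" "y \<in> C'"
        and h: "?h = inv (the (\<theta> x)) \<otimes> the (\<theta> y)"
        using mem_pot_graph[OF \<pi> X, of ?h] False cx cy by auto
      have "C' = C" using disjoint_block_eq[OF partial_partitionD(1)[OF \<pi>(1)]] C C' by blast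
      moreover have "the (\<eta> y) = ?g \<otimes> the (\<theta> y)"
        using h cx cy by (metis inv_closed inv_solve_left' m_assoc m_closed)
      ultimately show ?thesis using C' by simp
    qed
    then show ?thesis using C(1) cx by (intro bexI[of _ C] conjI bexI[of _ ?g]) auto
  qed
  have "refining \<tau> \<pi>" unfolding refining_def using block by blast
  moreover have "potential_equiv G \<tau> \<eta> \<theta>"
    unfolding potential_equiv_iff[OF \<tau>(2) \<theta>\<tau>] using block by blast
  ultimately show "refining \<tau> \<pi> \<and> potential_class G X \<tau> \<eta> = potential_class G X \<tau> \<theta>"
    using potential_class_eq_iff[OF \<tau>(2) \<theta>\<tau>] by blast
qed

section \<open>Meets\<close>

text \<open>Translates the common block demanded by \<open>mem_pot_graph\<close> into the relation
  whose classes are the blocks.\<close>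

lemma common_class_iff:
  assumes "equiv A r"
  shows "(\<exists>B\<in>A // r. x \<in> B \<and> y \<in> B) \<longleftrightarrow> (x, y) \<in> r"
proof
  assume "\<exists>B\<in>A // r. x \<in> B \<and> y \<in> B"
  then show "(x, y) \<in> r" using quotient_eq_iff[OF assms] by blast
next
  assume xy: "(x, y) \<in> r"
  then have "x \<in> A" using assms by (auto simp: equiv_def)
  then have "r `` {x} \<in> A // r" "x \<in> r `` {x}"
    using quotientI equiv_class_self[OF assms] by metis+
  then show "\<exists>B\<in>A // r. x \<in> B \<and> y \<in> B" using xy by blast
qed

text \<open>Inverting the equal quotients gives symmetry. For transitivity, disjointness identifies
  the blocks meeting at \<open>y\<close>, and the quotients multiply.\<close>

lemma equiv_meet_rel:
  assumes \<pi>: "disjoint \<pi>" "\<theta> \<in> potentials G X \<pi>" and \<tau>: "disjoint \<tau>" "\<eta> \<in> potentials G X \<tau>"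
  shows "equiv (supp \<pi> \<inter> supp \<tau>) (meet_rel G \<pi> \<theta> \<tau> \<eta>)"
proof (rule equivI)
  have c: "the (\<theta> x) \<in> carrier G" "the (\<eta> x) \<in> carrier G" if "x \<in> C" "C \<in> \<pi>" "x \<in> B" "B \<in> \<tau>"
    for x B C
    using that \<pi>(2) \<tau>(2) by (auto intro: potentials_carrier)
  show "meet_rel G \<pi> \<theta> \<tau> \<eta> \<subseteq> (supp \<pi> \<inter> supp \<tau>) \<times> (supp \<pi> \<inter> supp \<tau>)"
    by (auto simp: meet_rel_def)
  show "refl_on (supp \<pi> \<inter> supp \<tau>) (meet_rel G \<pi> \<theta> \<tau> \<eta>)"
  proof (rule refl_onI)
    fix x assume "x \<in> supp \<pi> \<inter> supp \<tau>"
    then obtain B C where BC: "B \<in> \<tau>" "C \<in> \<pi>" "x \<in> B \<inter> C" by blast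
    then have "inv (the (\<theta> x)) \<otimes> the (\<theta> x) = inv (the (\<eta> x)) \<otimes> the (\<eta> x)"
      using c[of x C B] by simp
    then show "(x, x) \<in> meet_rel G \<pi> \<theta> \<tau> \<eta>" using BC by (auto simp: meet_rel_def)
  qed
  show "sym (meet_rel G \<pi> \<theta> \<tau> \<eta>)"
  proof (rule symI)
    fix x y assume "(x, y) \<in> meet_rel G \<pi> \<theta> \<tau> \<eta>"
    then obtain B C where BC: "B \<in> \<tau>" "C \<in> \<pi>" "x \<in> B" "x \<in> C" "y \<in> B" "y \<in> C"
      and e: "inv (the (\<theta> x)) \<otimes> the (\<theta> y) = inv (the (\<eta> x)) \<otimes> the (\<eta> y)"
      by (auto simp: meet_rel_def)
    have "inv (inv (the (\<theta> x)) \<otimes> the (\<theta> y)) = inv (inv (the (\<eta> x)) \<otimes> the (\<eta> y))"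
      using e by simp
    then have "inv (the (\<theta> y)) \<otimes> the (\<theta> x) = inv (the (\<eta> y)) \<otimes> the (\<eta> x)"
      using BC c by (simp add: inv_mult_group)
    then show "(y, x) \<in> meet_rel G \<pi> \<theta> \<tau> \<eta>" using BC by (auto simp: meet_rel_def)
  qed
  show "trans (meet_rel G \<pi> \<theta> \<tau> \<eta>)"
  proof (rule transI)
    fix x y z assume xy: "(x, y) \<in> meet_rel G \<pi> \<theta> \<tau> \<eta>" and yz: "(y, z) \<in> meet_rel G \<pi> \<theta> \<tau> \<eta>"
    obtain B C where BC: "B \<in> \<tau>" "C \<in> \<pi>" "x \<in> B" "x \<in> C" "y \<in> B" "y \<in> C"
      and e: "inv (the (\<theta> x)) \<otimes> the (\<theta> y) = inv (the (\<eta> x)) \<otimes> the (\<eta> y)"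
      using xy by (auto simp: meet_rel_def)
    obtain B' C' where BC': "B' \<in> \<tau>" "C' \<in> \<pi>" "y \<in> B'" "y \<in> C'" "z \<in> B'" "z \<in> C'"
      and e': "inv (the (\<theta> y)) \<otimes> the (\<theta> z) = inv (the (\<eta> y)) \<otimes> the (\<eta> z)"
      using yz by (auto simp: meet_rel_def)
    have "B' = B" "C' = C" using disjoint_block_eq[OF \<tau>(1)] disjoint_block_eq[OF \<pi>(1)] BC BC' by blast+
    moreover have "inv (the (\<theta> x)) \<otimes> the (\<theta> z) =
        (inv (the (\<theta> x)) \<otimes> the (\<theta> y)) \<otimes> (inv (the (\<theta> y)) \<otimes> the (\<theta> z))"
      using BC BC' c by (simp add: inv_mult_cancel)
    moreover have "inv (the (\<eta> x)) \<otimes> the (\<eta> z) =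
        (inv (the (\<eta> x)) \<otimes> the (\<eta> y)) \<otimes> (inv (the (\<eta> y)) \<otimes> the (\<eta> z))"
      using BC BC' c by (simp add: inv_mult_cancel)
    ultimately show "(x, z) \<in> meet_rel G \<pi> \<theta> \<tau> \<eta>"
      using BC BC' e e' by (auto simp: meet_rel_def)
  qed
qed

lemma meet_partition_props:
  assumes \<pi>: "partial_partition X \<pi>" "\<theta> \<in> potentials G X \<pi>"
    and \<tau>: "partial_partition X \<tau>" "\<eta> \<in> potentials G X \<tau>"
  defines "\<rho> \<equiv> meet_partition G \<pi> \<theta> \<tau> \<eta>"
  shows "partial_partition X \<rho>" "supp \<rho> = supp \<pi> \<inter> supp \<tau>" "\<theta> \<in> potentials G X \<rho>"
    and "(\<exists>D\<in>\<rho>. x \<in> D \<and> y \<in> D) \<longleftrightarrow> (x, y) \<in> meet_rel G \<pi> \<theta> \<tau> \<eta>"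
proof -
  let ?R = "meet_rel G \<pi> \<theta> \<tau> \<eta>"
  have eq: "equiv (supp \<pi> \<inter> supp \<tau>) ?R"
    using equiv_meet_rel partial_partitionD(1) assms(1-4) by blast
  then have p: "partition_on (supp \<pi> \<inter> supp \<tau>) \<rho>"
    unfolding \<rho>_def meet_partition_def by (rule partition_on_quotient)
  have "supp \<pi> \<inter> supp \<tau> \<subseteq> X" using partial_partitionD(2)[OF \<pi>(1)] by blast
  then show "partial_partition X \<rho>" using p unfolding partial_partition_def by blast
  show sup: "supp \<rho> = supp \<pi> \<inter> supp \<tau>" using p by (simp add: partition_on_def)
  then show "\<theta> \<in> potentials G X \<rho>" using \<pi>(2) by (auto simp: potentials_def)
  show "(\<exists>D\<in>\<rho>. x \<in> D \<and> y \<in> D) \<longleftrightarrow> (x, y) \<in> ?R"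
    unfolding \<rho>_def meet_partition_def using eq by (rule common_class_iff)
qed

lemma edge_sets_eqI:
  assumes "E \<subseteq> edges expansion" "F \<subseteq> edges expansion"
    and "\<And>x g y. x \<in> X \<Longrightarrow> y \<in> X \<Longrightarrow> x \<noteq> y \<Longrightarrow> g \<in> carrier G \<Longrightarrow> edge x g y \<in> E \<longleftrightarrow> edge x g y \<in> F"
  shows "E = F"
  using assms edge_cases by (metis subset_antisym subset_iff)

text \<open>An edge from \<open>x\<close> to \<open>y\<close> lies in both subgraphs iff
  \<open>x\<close> and \<open>y\<close> share a block of each partition and its gain equals both
  quotients. Such a gain exists iff the quotients agree, which is the condition in
  \<open>meet_rel\<close>.\<close>

lemma pot_graph_meet:
  assumes \<pi>: "partial_partition X \<pi>" "\<theta> \<in> potentials G X \<pi>"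
    and \<tau>: "partial_partition X \<tau>" "\<eta> \<in> potentials G X \<tau>"
  shows "pot_graph (meet_partition G \<pi> \<theta> \<tau> \<eta>) \<theta> = sub_inter (pot_graph \<pi> \<theta>) (pot_graph \<tau> \<eta>)"
    (is "pot_graph ?\<rho> \<theta> = _")
proof (rule prod_eqI)
  note \<rho> = meet_partition_props[OF assms]
  show "fst (pot_graph ?\<rho> \<theta>) = fst (sub_inter (pot_graph \<pi> \<theta>) (pot_graph \<tau> \<eta>))"
    using \<rho>(2) by (simp add: pot_graph_def sub_inter_def)
  show "snd (pot_graph ?\<rho> \<theta>) = snd (sub_inter (pot_graph \<pi> \<theta>) (pot_graph \<tau> \<eta>))"
  proof (rule edge_sets_eqI)
    show "snd (pot_graph ?\<rho> \<theta>) \<subseteq> edges expansion" using pot_graph_edges[OF \<rho>(1,3)] .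
    show "snd (sub_inter (pot_graph \<pi> \<theta>) (pot_graph \<tau> \<eta>)) \<subseteq> edges expansion"
      using pot_graph_edges[OF \<pi>] by (auto simp: sub_inter_def)
    fix x g y assume xy: "x \<in> X" "y \<in> X" "x \<noteq> y" "g \<in> carrier G"
    have "edge x g y \<in> snd (pot_graph ?\<rho> \<theta>) \<longleftrightarrow>
        (x, y) \<in> meet_rel G \<pi> \<theta> \<tau> \<eta> \<and> g = inv (the (\<theta> x)) \<otimes> the (\<theta> y)"
      using mem_pot_graph[OF \<rho>(1,3) xy] \<rho>(4)[of x y] by blast
    also have "\<dots> \<longleftrightarrow> edge x g y \<in> snd (pot_graph \<pi> \<theta>) \<and> edge x g y \<in> snd (pot_graph \<tau> \<eta>)"
      unfolding mem_pot_graph[OF \<pi> xy] mem_pot_graph[OF \<tau> xy] meet_rel_def by auto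
    finally show "edge x g y \<in> snd (pot_graph ?\<rho> \<theta>) \<longleftrightarrow>
        edge x g y \<in> snd (sub_inter (pot_graph \<pi> \<theta>) (pot_graph \<tau> \<eta>))"
      by (simp add: sub_inter_def)
  qed
qed

section \<open>Closed balanced subgraphs come from potentials\<close>

context
  fixes V :: "'x set" and E :: "('g \<times> 'x set) set"
  assumes sub: "subgraph expansion (V, E)" and cb: "closed_balanced G expansion (V, E)"
begin

text \<open>The expansion of a complete graph has no loops; the clause for \<open>x = y\<close> adds
  identities, so that the joins form a groupoid with units, inverses and products.\<close>

definition joins :: "'x \<Rightarrow> 'g \<Rightarrow> 'x \<Rightarrow> bool" where
  "joins x g y \<longleftrightarrow> x \<in> V \<and> y \<in> V \<and> g \<in> carrier G \<and> (if x = y then g = \<one> else edge x g y \<in> E)"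

lemma V_subset: "V \<subseteq> X" and E_subset: "E \<subseteq> edges expansion"
  using sub by (auto simp: subgraph_def group_expansion_def complete_graph_def)

lemma mem_E_iff_joins:
  assumes "x \<in> X" "y \<in> X" "x \<noteq> y" "g \<in> carrier G"
  shows "edge x g y \<in> E \<longleftrightarrow> joins x g y"
proof
  assume e: "edge x g y \<in> E"
  then have "ends expansion (edge x g y) \<subseteq> V" using sub by (auto simp: subgraph_def)
  then have "{x, y} \<subseteq> V"
    using arc_props(5)[OF assms] by (simp add: group_expansion_def complete_graph_def split_beta)
  then show "joins x g y" using e assms by (simp add: joins_def)
qed (use assms(3) in \<open>simp add: joins_def\<close>)

lemma joins_refl: "x \<in> V \<Longrightarrow> joins x \<one> x"
  by (simp add: joins_def)

lemma joins_sym: "joins x g y \<Longrightarrow> joins y (inv g) x"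
  using edge_flip[of x y g] V_subset by (auto simp: joins_def subset_iff)

text \<open>Two parallel edges with different gains would form an unbalanced digon.\<close>

lemma joins_unique:
  assumes "joins x g y" "joins x h y"
  shows "g = h"
proof (cases "x = y")
  case True
  then show ?thesis using assms by (simp add: joins_def)
next
  case False
  have X: "x \<in> X" "y \<in> X" and gh: "g \<in> carrier G" "h \<in> carrier G"
    and E: "edge x g y \<in> E" "edge x h y \<in> E" and V: "x \<in> V" "y \<in> V"
    using assms False V_subset by (auto simp: joins_def)
  note props = arc_props[OF X False gh(1)] arc_props[of y x "inv h"] edge_flip[OF X False gh(2)]
  show ?thesis
  proof (rule ccontr)
    assume "g \<noteq> h"
    let ?p = "[arc x g y, arc y (inv h) x]"
    \<comment> \<open>A closed path of length two is simple only if its edges differ; this is where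
      \<open>g \<noteq> h\<close> enters.\<close>
    have "edge x g y \<noteq> edge x h y" using edge_gain_unique[OF X False gh] \<open>g \<noteq> h\<close> by blast
    then have p: "simple_closed_path expansion ?p"
      using props X gh False by (simp add: simple_closed_path_iff_rotate1)
    have "sub_le (path_graph expansion ?p) (V, E)"
      using props X gh False E V by (simp add: sub_le_def path_graph_def)
    then have "balanced_circle G expansion (path_graph expansion ?p)"
      using cb p unfolding closed_balanced_def balanced_def circle_def by blast
    then have "g \<otimes> (inv h \<otimes> \<one>) = \<one>"
      using p props X gh False by (auto simp: balanced_circle_def path_gain_def)
    then show False using gh \<open>g \<noteq> h\<close> by (metis inv_closed inv_equality inv_inv r_one)
  qed
qed

text \<open>For three distinct vertices, the edge from \<open>x\<close> to \<open>z\<close> with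
  gain \<open>g \<otimes> h\<close> completes a balanced triangle, so closure puts it into
  \<open>E\<close>.\<close>

lemma joins_trans:
  assumes "joins x g y" "joins y h z"
  shows "joins x (g \<otimes> h) z"
proof -
  have X: "x \<in> X" "y \<in> X" "z \<in> X" and gh: "g \<in> carrier G" "h \<in> carrier G"
    and V: "x \<in> V" "y \<in> V" "z \<in> V"
    using assms V_subset by (auto simp: joins_def)
  consider "x = y" | "y = z" | "x = z" | "x \<noteq> y" "y \<noteq> z" "x \<noteq> z" by blast
  then show ?thesis
  proof cases
    case 1
    then show ?thesis using assms gh by (simp add: joins_def)
  next
    case 2
    then show ?thesis using assms gh by (simp add: joins_def)
  next
    case 3
    \<comment> \<open>The second join, reversed, runs parallel to the first, so
      \<open>g \<otimes> h\<close> is the unit.\<close>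
    then have "g = inv h" using assms joins_unique joins_sym by blast
    then show ?thesis using 3 V gh by (simp add: joins_def)
  next
    case 4
    let ?k = "g \<otimes> h"
    let ?p = "[arc x g y, arc y h z, arc z (inv ?k) x]"
    let ?C = "path_graph expansion ?p"
    have k: "?k \<in> carrier G" using gh by simp
    have xy: "edge x g y \<in> E" and yz: "edge y h z \<in> E" using assms 4 by (auto simp: joins_def)
    note props = arc_props[OF X(1,2) 4(1) gh(1)] arc_props[OF X(2,3) 4(2) gh(2)]
      arc_props[of z x "inv ?k"]
    have flip: "edge z (inv ?k) x = edge x ?k z" using edge_flip[OF X(1,3) 4(3) k] .
    \<comment> \<open>Edges with different ends are different, whatever their labels.\<close>
    have ends: "{x, y} \<noteq> {y, z}" "{x, y} \<noteq> {z, x}" "{y, z} \<noteq> {z, x}"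
      using 4 by (auto simp: doubleton_eq_iff)
    have "distinct (map fst ?p)"
      using ends props X k 4
      by (simp del: distinct.simps) (metis distinct_length_2_or_more distinct_singleton inv_closed)
    then have p: "simple_closed_path expansion ?p"
      using props X k 4 by (auto simp: simple_closed_path_iff_rotate1)
    have sndC: "snd ?C = {edge x g y, edge y h z, edge x ?k z}"
      by (simp add: path_graph_def flip)
    \<comment> \<open>The gains from \<open>x\<close> form a potential on the triangle (the last
      branch serves \<open>z\<close>); this settles all its representations as a closed path at
      once.\<close>
    define f where "f = (\<lambda>v. if v = x then \<one> else if v = y then g else ?k)"
    have f: "f x = \<one>" "f y = g" "f z = ?k" using 4 by (simp_all add: f_def)
    have "balanced_circle G expansion ?C"
    proof (rule balanced_circle_if_potential)
      show "circle expansion ?C" using p by (auto simp: circle_def)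
      fix e b assume "e \<in> snd ?C"
      then consider "e = edge x g y" | "e = edge y h z" | "e = edge x ?k z" using sndC by blast
      then show "potential_gain G expansion f (e, b)"
      proof cases
        case 1
        show ?thesis
          unfolding 1 by (rule potential_gain_arc[OF X(1,2) 4(1) gh(1)]) (simp_all add: f gh)
      next
        case 2
        have "h = inv g \<otimes> ?k" using gh by (simp flip: m_assoc)
        then show ?thesis
          unfolding 2 by (intro potential_gain_arc[OF X(2,3) 4(2) gh(2)]) (simp_all add: f gh)
      next
        case 3
        show ?thesis
          unfolding 3 by (rule potential_gain_arc[OF X(1,3) 4(3) k]) (simp_all add: f gh)
      qed
    qed
    moreover have "sub_le (delete_edge ?C (edge x ?k z)) (V, E)"
      using sndC xy yz V props X k 4 by (auto simp: sub_le_def delete_edge_def path_graph_def)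
    ultimately have "edge x ?k z \<in> E"
      using cb sndC unfolding closed_balanced_def snd_conv by blast
    then show ?thesis using V k 4 by (simp add: joins_def)
  qed
qed

text \<open>The blocks are the classes of joined vertices, and the potential at a vertex is the gain
  from the root of its class.\<close>

lemma pot_graph_exists:
  obtains \<pi> \<theta> where "partial_partition X \<pi>" "\<theta> \<in> potentials G X \<pi>" "pot_graph \<pi> \<theta> = (V, E)"
proof -
  define R where "R = {(x, y). \<exists>g. joins x g y}"
  have eq: "equiv V R"
  proof (rule equivI)
    show "R \<subseteq> V \<times> V" by (auto simp: R_def joins_def)
    show "refl_on V R" using joins_refl by (auto simp: R_def refl_on_def)
    show "sym R" using joins_sym by (auto simp: R_def intro!: symI)
    show "trans R" unfolding R_def trans_def using joins_trans by blast
  qed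
  define \<pi> where "\<pi> = V // R"
  have part: "partition_on V \<pi>" unfolding \<pi>_def using eq by (rule partition_on_quotient)
  then have pp: "partial_partition X \<pi>" using V_subset by (auto simp: partial_partition_def)
  have supp: "supp \<pi> = V" using part by (simp add: partition_on_def)
  \<comment> \<open>The choice depends only on the class as a set, so equivalent vertices get the
    same root.\<close>
  define root where "root x = (SOME r. r \<in> R `` {x})" for x
  define pot where "pot x = (SOME g. joins (root x) g x)" for x
  define \<theta> where "\<theta> x = (if x \<in> V then Some (pot x) else None)" for x
  have pot: "joins (root x) (pot x) x" if x: "x \<in> V" for x
  proof -
    have "x \<in> R `` {x}" using eq x by (rule equiv_class_self)
    then have "root x \<in> R `` {x}" unfolding root_def by (rule someI)
    then have "\<exists>g. joins (root x) g x" using joins_sym by (auto simp: R_def)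
    then show ?thesis unfolding pot_def by (rule someI_ex)
  qed
  then have potc: "pot x \<in> carrier G" if "x \<in> V" for x using that by (auto simp: joins_def)
  have \<theta>: "\<theta> \<in> potentials G X \<pi>"
    using supp V_subset potc by (auto simp: potentials_def \<theta>_def ran_def split: if_splits)
  have joins_iff: "joins x g y \<longleftrightarrow> (x, y) \<in> R \<and> g = inv (pot x) \<otimes> pot y" for x g y
  proof -
    \<comment> \<open>Go from \<open>x\<close> back to the common root and from there to
      \<open>y\<close>.\<close>
    have *: "joins x (inv (pot x) \<otimes> pot y) y" if xy: "(x, y) \<in> R"
    proof -
      have "R `` {x} = R `` {y}" using equiv_class_eq[OF eq xy] .
      then have "root x = root y" by (simp add: root_def)
      moreover have "x \<in> V" "y \<in> V" using xy by (auto simp: R_def joins_def)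
      ultimately show ?thesis using pot joins_sym joins_trans by metis
    qed
    then show ?thesis using joins_unique by (auto simp: R_def)
  qed
  have "snd (pot_graph \<pi> \<theta>) = E"
  proof (rule edge_sets_eqI[OF pot_graph_edges[OF pp \<theta>] E_subset])
    fix x g y assume xy: "x \<in> X" "y \<in> X" "x \<noteq> y" "g \<in> carrier G"
    have "edge x g y \<in> snd (pot_graph \<pi> \<theta>) \<longleftrightarrow>
        (\<exists>B\<in>\<pi>. x \<in> B \<and> y \<in> B) \<and> g = inv (the (\<theta> x)) \<otimes> the (\<theta> y)"
      using mem_pot_graph[OF pp \<theta> xy] by blast
    also have "(\<exists>B\<in>\<pi>. x \<in> B \<and> y \<in> B) \<longleftrightarrow> (x, y) \<in> R"
      unfolding \<pi>_def using eq by (rule common_class_iff)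
    also have "(x, y) \<in> R \<and> g = inv (the (\<theta> x)) \<otimes> the (\<theta> y) \<longleftrightarrow> joins x g y"
      unfolding joins_iff by (auto simp: \<theta>_def R_def joins_def)
    finally show "edge x g y \<in> snd (pot_graph \<pi> \<theta>) \<longleftrightarrow> edge x g y \<in> E"
      using mem_E_iff_joins[OF xy] by simp
  qed
  then have "pot_graph \<pi> \<theta> = (V, E)" using supp by (simp add: pot_graph_def)
  then show ?thesis using that pp \<theta> by blast
qed

end

section \<open>The isomorphism\<close>

definition rhodes_graph :: "('x, 'g) partition_potential \<Rightarrow> ('x, 'g \<times> 'x set) sub" where
  "rhodes_graph = (\<lambda>(\<pi>, T). pot_graph \<pi> (rep T))"

text \<open>A block is squeezed between itself and another block of \<open>\<pi>\<close>; being
  nonempty, it equals that block by disjointness, and hence also the block of \<open>\<tau>\<close>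
  in between.\<close>

lemma subset_if_refining_both:
  assumes "partial_partition X \<pi>" "refining \<pi> \<tau>" "refining \<tau> \<pi>"
  shows "\<pi> \<subseteq> \<tau>"
proof
  fix B assume B: "B \<in> \<pi>"
  then obtain C B' where C: "C \<in> \<tau>" "B \<subseteq> C" "B' \<in> \<pi>" "C \<subseteq> B'"
    using assms(2,3) unfolding refining_def by blast
  obtain x where "x \<in> B" using B partial_partitionD(3)[OF assms(1)] by fastforce
  then have "B' = B" using disjoint_block_eq[OF partial_partitionD(1)[OF assms(1)]] B C by blast
  then show "B \<in> \<tau>" using C by (metis subset_antisym)
qed

text \<open>By \<open>sub_le_pot_graph_iff\<close>, equivalent potentials give subgraphs contained
  in each other, so the chosen representative is immaterial.\<close>

lemma rhodes_graph_class:
  assumes "partial_partition X \<pi>" "\<theta> \<in> potentials G X \<pi>"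
  shows "rhodes_graph (\<pi>, potential_class G X \<pi> \<theta>) = pot_graph \<pi> \<theta>"
proof -
  let ?r = "rep (potential_class G X \<pi> \<theta>)"
  have r: "?r \<in> potentials G X \<pi>" using rep_class(1)[OF assms(2)] .
  have "refining \<pi> \<pi>" by (auto simp: refining_def)
  moreover have "potential_class G X \<pi> ?r = potential_class G X \<pi> \<theta>"
    using rep_class(2)[OF assms(2)] potential_class_eq_iff[OF r assms(2)] by blast
  ultimately have "sub_le (pot_graph \<pi> ?r) (pot_graph \<pi> \<theta>)" "sub_le (pot_graph \<pi> \<theta>) (pot_graph \<pi> ?r)"
    using sub_le_pot_graph_iff assms r by auto
  then show ?thesis by (auto simp: rhodes_graph_def sub_le_def prod_eq_iff)
qed

lemma rhodes_carrier_cases: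
  assumes "x \<in> rhodes_carrier G X"
  obtains \<pi> \<theta> where "partial_partition X \<pi>" "\<theta> \<in> potentials G X \<pi>"
    "x = (\<pi>, potential_class G X \<pi> \<theta>)"
  using assms unfolding rhodes_carrier_def by blast

lemma rhodes_graph_le:
  assumes "x \<in> rhodes_carrier G X" "y \<in> rhodes_carrier G X"
  shows "rhodes_le G X x y \<longleftrightarrow> sub_le (rhodes_graph x) (rhodes_graph y)"
  using assms
  by (elim rhodes_carrier_cases) (simp add: rhodes_le_eq sub_le_pot_graph_iff rhodes_graph_class)

lemma rhodes_graph_meet:
  assumes "x \<in> rhodes_carrier G X" "y \<in> rhodes_carrier G X"
  shows "rhodes_meet G X x y \<in> rhodes_carrier G X"
    and "rhodes_graph (rhodes_meet G X x y) = sub_inter (rhodes_graph x) (rhodes_graph y)"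
proof -
  obtain \<pi> \<theta> where \<pi>: "partial_partition X \<pi>" "\<theta> \<in> potentials G X \<pi>"
    and x: "x = (\<pi>, potential_class G X \<pi> \<theta>)" using assms(1) by (rule rhodes_carrier_cases)
  obtain \<tau> \<eta> where \<tau>: "partial_partition X \<tau>" "\<eta> \<in> potentials G X \<tau>"
    and y: "y = (\<tau>, potential_class G X \<tau> \<eta>)" using assms(2) by (rule rhodes_carrier_cases)
  note \<rho> = meet_partition_props[OF \<pi> \<tau>]
  have m: "rhodes_meet G X x y =
      (meet_partition G \<pi> \<theta> \<tau> \<eta>, potential_class G X (meet_partition G \<pi> \<theta> \<tau> \<eta>) \<theta>)"
    unfolding x y using rhodes_meet_eq(1) partial_partitionD(1) \<pi> \<tau> by blast
  then show "rhodes_meet G X x y \<in> rhodes_carrier G X"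
    using \<rho>(1,3) by (auto simp: rhodes_carrier_def)
  show "rhodes_graph (rhodes_meet G X x y) = sub_inter (rhodes_graph x) (rhodes_graph y)"
    unfolding m using pot_graph_meet[OF \<pi> \<tau>] rhodes_graph_class \<pi> \<tau> \<rho> x y by simp
qed

text \<open>If two images coincide, the order criterion applies in both directions: the partitions
  refine each other and the classes agree. Surjectivity is \<open>pot_graph_exists\<close>.\<close>

lemma bij_rhodes_graph:
  "bij_betw rhodes_graph (rhodes_carrier G X) (carrier (graphic_rhodes G expansion))"
proof (rule bij_betw_imageI)
  show "inj_on rhodes_graph (rhodes_carrier G X)"
  proof (rule inj_onI)
    fix x y assume x: "x \<in> rhodes_carrier G X" and y: "y \<in> rhodes_carrier G X"
      and eq: "rhodes_graph x = rhodes_graph y"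
    obtain \<pi> \<theta> where \<pi>: "partial_partition X \<pi>" "\<theta> \<in> potentials G X \<pi>"
      "x = (\<pi>, potential_class G X \<pi> \<theta>)" using x by (rule rhodes_carrier_cases)
    obtain \<tau> \<eta> where \<tau>: "partial_partition X \<tau>" "\<eta> \<in> potentials G X \<tau>"
      "y = (\<tau>, potential_class G X \<tau> \<eta>)" using y by (rule rhodes_carrier_cases)
    have "sub_le (pot_graph \<pi> \<theta>) (pot_graph \<tau> \<eta>)" "sub_le (pot_graph \<tau> \<eta>) (pot_graph \<pi> \<theta>)"
      using eq rhodes_graph_class \<pi> \<tau> by (simp_all add: sub_le_def)
    then have "refining \<pi> \<tau>" "refining \<tau> \<pi>"
      "potential_class G X \<pi> \<theta> = potential_class G X \<pi> \<eta>"
      using sub_le_pot_graph_iff \<pi> \<tau> by blast+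
    moreover from this have "\<pi> = \<tau>" using subset_if_refining_both \<pi>(1) \<tau>(1) by (meson subset_antisym)
    ultimately show "x = y" using \<pi>(3) \<tau>(3) by simp
  qed
  show "rhodes_graph ` rhodes_carrier G X = carrier (graphic_rhodes G expansion)"
  proof (intro equalityI subsetI)
    fix A assume "A \<in> rhodes_graph ` rhodes_carrier G X"
    then obtain x where x: "x \<in> rhodes_carrier G X" "A = rhodes_graph x" by blast
    obtain \<pi> \<theta> where \<pi>: "partial_partition X \<pi>" "\<theta> \<in> potentials G X \<pi>"
      "x = (\<pi>, potential_class G X \<pi> \<theta>)" using x(1) by (rule rhodes_carrier_cases)
    then show "A \<in> carrier (graphic_rhodes G expansion)"
      using x(2) rhodes_graph_class subgraph_pot_graph closed_balanced_pot_graph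
      by (simp add: graphic_rhodes_def)
  next
    fix A assume A: "A \<in> carrier (graphic_rhodes G expansion)"
    obtain V E where VE: "A = (V, E)" by (cases A)
    obtain \<pi> \<theta> where \<pi>: "partial_partition X \<pi>" "\<theta> \<in> potentials G X \<pi>" "pot_graph \<pi> \<theta> = (V, E)"
      using pot_graph_exists[of V E] A VE by (auto simp: graphic_rhodes_def)
    have "(\<pi>, potential_class G X \<pi> \<theta>) \<in> rhodes_carrier G X"
      using \<pi>(1,2) by (auto simp: rhodes_carrier_def)
    then show "A \<in> rhodes_graph ` rhodes_carrier G X"
      using rhodes_graph_class[OF \<pi>(1,2)] \<pi>(3) VE by (metis image_eqI)
  qed
qed

end

theorem theorem2p4:
  fixes G :: "('g, 'm) monoid_scheme" and X :: "'x set" and n :: nat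
    and d :: "'x set \<Rightarrow> 'x \<times> 'x"
  assumes "group G" and "finite X" and "card X = n"
    and "orientation (complete_graph X) d"
  shows "meet_semilattice (partition_rhodes G X) \<and>
    meet_semilattice (graphic_rhodes G (group_expansion G (complete_graph X) d)) \<and>
    (\<exists>f. meet_semilattice_iso f (partition_rhodes G X)
       (graphic_rhodes G (group_expansion G (complete_graph X) d)))"
proof -
  interpret group G by fact
  interpret complete_expansion G X d by unfold_locales fact
  let ?S = "partition_rhodes G X" and ?T = "graphic_rhodes G expansion"
  have T: "meet_semilattice ?T" by (rule meet_semilattice_graphic_rhodes)
  have bij: "bij_betw rhodes_graph (carrier ?S) (carrier ?T)"
    using bij_rhodes_graph by (simp add: partition_rhodes_def)
  have le: "x \<sqsubseteq>\<^bsub>?S\<^esub> y \<longleftrightarrow> rhodes_graph x \<sqsubseteq>\<^bsub>?T\<^esub> rhodes_graph y"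
    if "x \<in> carrier ?S" "y \<in> carrier ?S" for x y
    using that rhodes_graph_le by (simp add: partition_rhodes_def graphic_rhodes_def)
  have closed: "x \<triangle>\<^bsub>?S\<^esub> y \<in> carrier ?S" if "x \<in> carrier ?S" "y \<in> carrier ?S" for x y
    using that rhodes_graph_meet(1) by (simp add: partition_rhodes_def)
  have wedge: "rhodes_graph (x \<triangle>\<^bsub>?S\<^esub> y) = rhodes_graph x \<triangle>\<^bsub>?T\<^esub> rhodes_graph y"
    if "x \<in> carrier ?S" "y \<in> carrier ?S" for x y
    using that rhodes_graph_meet(2) by (simp add: partition_rhodes_def graphic_rhodes_def)
  \<comment> \<open>The axioms on the side of partitions are inherited from intersections of
    subgraphs.\<close>
  have "meet_semilattice ?S"
    by (rule meet_semilattice_transport[OF T _ _ bij le closed wedge])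
      (simp_all add: partition_rhodes_def graphic_rhodes_def)
  moreover have "meet_semilattice_iso rhodes_graph ?S ?T"
    using bij le wedge unfolding meet_semilattice_iso_def by blast
  ultimately show ?thesis using T by blast
qed

end
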